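(* The class of $\omega$-languages recognized by deterministic weak reset Parikh automata is not closed under union, not closed under intersection, and not closed under complement. (That is, for each of these operations there is a finite alphabet $\Sigma$ and $\omega$-languages over $\Sigma$ in the class such that the result of applying the operation, with complement taken relative to $\Sigma^\omega$, is not in the class.)
   Context: $\mathbb{N}=\{0,1,2,\dots\}$. A linear set is a set $C(\mathbf{b},P)=\{\mathbf{b}+\mathbf{p}_1z_1+\dots+\mathbf{p}_\ell z_\ell \mid z_1,\dots,z_\ell\in\mathbb{N}\}\subseteq\mathbb{N}^d$ with $\mathbf{b}\in\mathbb{N}^d$ and $P=\{\mathbf{p}_1,\dots,\mathbf{p}_\ell\}\subseteq\mathbb{N}^d$ finite ($\ell\ge 0$); a semi-linear set is a finite union of linear sets. A Parikh automaton (PA) of dimension $d\ge 1$ is a tuple $\mathcal{A}=(Q,\Sigma,q_0,\Delta,F,C)$ with a finite state set $Q$, a finite non-empty alphabet $\Sigma$, an initial state $q_0\in Q$, a finite set of labeled transitions $\Delta\subseteq Q\times\Sigma\times\mathbb{N}^d\times Q$, a set of accepting states $F\subseteq Q$, and a semi-linear set $C\subseteq\mathbb{N}^d$. It is deterministic if for every $(p,a)\in Q\times\Sigma$ there is exactly one transition $(p,a,\mathbf{v},q)\in\Delta$. A run on $\alpha=\alpha_1\alpha_2\dots\in\Sigma^\omega$ is an infinite sequence $r=r_1r_2\dots$ with $r_i=(p_{i-1},\alpha_i,\mathbf{v}_i,p_i)\in\Delta$ and $p_0=q_0$; write $\rho(r_m\dots r_n)=\sum_{i=m}^n\mathbf{v}_i$.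 A weak reset PA is a PA in which $r$ is accepting iff there are infinitely many positions $0=k_0<k_1<k_2<\dots$ such that $p_{k_i}\in F$ and $\rho(r_{k_{i-1}+1}\dots r_{k_i})\in C$ for all $i\ge 1$. The recognized $\omega$-language is the set of all $\alpha\in\Sigma^\omega$ on which there is an accepting run. *)

theory Defs
  imports "HOL-Library.Countable_Set"
begin

text \<open>
  Since the dimension of a Parikh automaton is existentially quantified in the class of recognized
  languages, a vector of dimension \<open>d\<close> is represented by a function on \<^typ>\<open>nat\<close> whose coordinates
  are \<open>0, \<dots>, d - 1\<close> and which vanishes from \<open>d\<close> on.
\<close>

type_synonym nvec = "nat \<Rightarrow> nat"

definition nvecs :: "nat \<Rightarrow> nvec set" where
  "nvecs d = {v. \<forall>j\<ge>d. v j = 0}"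

definition lin_comb :: "nvec \<Rightarrow> nvec set \<Rightarrow> nvec set" where
  "lin_comb b P = {(\<lambda>j. b j + (\<Sum>p\<in>P. p j * z p)) | z :: nvec \<Rightarrow> nat. True}"

definition linear_set :: "nat \<Rightarrow> nvec set \<Rightarrow> bool" where
  "linear_set d S \<longleftrightarrow> (\<exists>b P. b \<in> nvecs d \<and> finite P \<and> P \<subseteq> nvecs d \<and> S = lin_comb b P)"

definition semilinear_set :: "nat \<Rightarrow> nvec set \<Rightarrow> bool" where
  "semilinear_set d S \<longleftrightarrow> (\<exists>\<L>. finite \<L> \<and> (\<forall>L\<in>\<L>. linear_set d L) \<and> S = \<Union>\<L>)"

record ('q, 'a) pa =
  dim :: nat
  states :: "'q set"
  alphabet :: "'a set"
  init :: 'q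
  trans :: "('q \<times> 'a \<times> nvec \<times> 'q) set"
  acc :: "'q set"
  constr :: "nvec set"

definition parikh_automaton :: "('q, 'a) pa \<Rightarrow> bool" where
  "parikh_automaton A \<longleftrightarrow>
     dim A \<ge> 1 \<and>
     finite (states A) \<and>
     finite (alphabet A) \<and> alphabet A \<noteq> {} \<and>
     init A \<in> states A \<and>
     finite (trans A) \<and>
     trans A \<subseteq> states A \<times> alphabet A \<times> nvecs (dim A) \<times> states A \<and>
     acc A \<subseteq> states A \<and>
     semilinear_set (dim A) (constr A)"

definition deterministic :: "('q, 'a) pa \<Rightarrow> bool" where
  "deterministic A \<longleftrightarrow>
     (\<forall>p\<in>states A. \<forall>a\<in>alphabet A. \<exists>!t. t \<in> trans A \<and> (\<exists>v q. t = (p, a, v, q)))"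

definition omega_words :: "'a set \<Rightarrow> (nat \<Rightarrow> 'a) set" where
  "omega_words \<Sigma> = {\<alpha>. \<forall>i. \<alpha> i \<in> \<Sigma>}"

text \<open>
  Words are indexed from \<open>0\<close>, so \<open>\<alpha> i\<close> is the letter \<open>\<alpha>\<^sub>i\<^sub>+\<^sub>1\<close>. A run on \<open>\<alpha>\<close> is given by its states
  \<open>p 0, p 1, \<dots>\<close> and its vectors, the transition \<open>r\<^sub>i\<^sub>+\<^sub>1\<close> being \<open>(p i, \<alpha> i, v i, p (i + 1))\<close>.
\<close>

definition is_run :: "('q, 'a) pa \<Rightarrow> (nat \<Rightarrow> 'a) \<Rightarrow> (nat \<Rightarrow> 'q) \<Rightarrow> (nat \<Rightarrow> nvec) \<Rightarrow> bool" where
  "is_run A \<alpha> p v \<longleftrightarrow> p 0 = init A \<and> (\<forall>i. (p i, \<alpha> i, v i, p (Suc i)) \<in> trans A)"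

text \<open>\<open>vec_sum v m n\<close> is \<open>\<rho>(r\<^sub>m\<^sub>+\<^sub>1 \<dots> r\<^sub>n)\<close>, the sum of the vectors read between positions \<open>m\<close> and \<open>n\<close>.\<close>

definition vec_sum :: "(nat \<Rightarrow> nvec) \<Rightarrow> nat \<Rightarrow> nat \<Rightarrow> nvec" where
  "vec_sum v m n = (\<lambda>j. \<Sum>i\<in>{m..<n}. v i j)"

definition weak_reset_accepting :: "('q, 'a) pa \<Rightarrow> (nat \<Rightarrow> 'q) \<Rightarrow> (nat \<Rightarrow> nvec) \<Rightarrow> bool" where
  "weak_reset_accepting A p v \<longleftrightarrow>
     (\<exists>k :: nat \<Rightarrow> nat. k 0 = 0 \<and> strict_mono k \<and>
        (\<forall>i\<ge>1. p (k i) \<in> acc A \<and> vec_sum v (k (i - 1)) (k i) \<in> constr A))"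

definition weak_reset_language :: "('q, 'a) pa \<Rightarrow> (nat \<Rightarrow> 'a) set" where
  "weak_reset_language A =
     {\<alpha> \<in> omega_words (alphabet A). \<exists>p v. is_run A \<alpha> p v \<and> weak_reset_accepting A p v}"

text \<open>
  State sets are finite, so drawing the states from \<^typ>\<open>nat\<close> is no restriction; this is lemma
  \<open>weak_reset_language_in_class\<close> below.
\<close>

definition det_weak_reset_class :: "'a set \<Rightarrow> (nat \<Rightarrow> 'a) set set" where
  "det_weak_reset_class \<Sigma> =
     {weak_reset_language A | A :: (nat, 'a) pa.
        parikh_automaton A \<and> deterministic A \<and> alphabet A = \<Sigma>}"

definition rename_states :: "('q \<Rightarrow> 'r) \<Rightarrow> ('q, 'a) pa \<Rightarrow> ('r, 'a) pa" where
  "rename_states f A =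
     \<lparr>dim = dim A, states = f ` states A, alphabet = alphabet A, init = f (init A),
      trans = (\<lambda>(p, a, v, q). (f p, a, v, f q)) ` trans A, acc = f ` acc A, constr = constr A\<rparr>"

lemma weak_reset_language_in_class:
  fixes A :: "('q, 'a) pa"
  assumes A: "parikh_automaton A" and det: "deterministic A"
  shows "weak_reset_language A \<in> det_weak_reset_class (alphabet A)"
proof -
  have fin: "finite (states A)" and init: "init A \<in> states A" and acc: "acc A \<subseteq> states A"
    and tr: "trans A \<subseteq> states A \<times> alphabet A \<times> nvecs (dim A) \<times> states A"
    using A by (auto simp: parikh_automaton_def)
  obtain f :: "'q \<Rightarrow> nat" where inj: "inj_on f (states A)"
    using countable_finite[OF fin] by (auto simp: countable_def)
  define B where "B = rename_states f A"
  have B_simps: "states B = f ` states A" "alphabet B = alphabet A" "init B = f (init A)"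
    "acc B = f ` acc A" "constr B = constr A" "dim B = dim A"
    "trans B = (\<lambda>(p, a, v, q). (f p, a, v, f q)) ` trans A"
    by (simp_all add: B_def rename_states_def)
  have trB: "(f p, a, v, f q) \<in> trans B \<longleftrightarrow> (p, a, v, q) \<in> trans A"
    if "p \<in> states A" "q \<in> states A" for p a v q
  proof
    assume "(f p, a, v, f q) \<in> trans B"
    then obtain p' q' where t: "(p', a, v, q') \<in> trans A" "f p = f p'" "f q = f q'"
      unfolding B_simps by auto
    then have "p' \<in> states A" "q' \<in> states A" using tr by blast+
    then have "p' = p" "q' = q" using t that inj by (auto dest: inj_onD)
    then show "(p, a, v, q) \<in> trans A" using t by simp
  next
    assume "(p, a, v, q) \<in> trans A"
    then show "(f p, a, v, f q) \<in> trans B" unfolding B_simps by force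
  qed
  have accB: "f p \<in> acc B \<longleftrightarrow> p \<in> acc A" if "p \<in> states A" for p
    using inj_on_image_mem_iff[OF inj that acc] by (simp add: B_simps)
  have "parikh_automaton B"
  proof -
    have "trans B \<subseteq> states B \<times> alphabet B \<times> nvecs (dim B) \<times> states B"
      using tr unfolding B_simps by auto
    moreover have "acc B \<subseteq> states B" using acc unfolding B_simps by auto
    moreover have "init B \<in> states B" using init unfolding B_simps by auto
    moreover have "finite (trans B)" "finite (states B)"
      using A unfolding parikh_automaton_def B_simps by simp_all
    ultimately show ?thesis
      using A unfolding parikh_automaton_def B_simps(2,5,6) by simp
  qed
  moreover have "deterministic B"
    unfolding deterministic_def B_simps(1,2)
  proof (intro ballI)
    fix p' a assume "p' \<in> f ` states A" and a: "a \<in> alphabet A"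
    then obtain p where p: "p \<in> states A" "p' = f p" by blast
    have ex: "\<exists>!t. t \<in> trans A \<and> (\<exists>v q. t = (p, a, v, q))"
      using det p a by (auto simp: deterministic_def)
    then obtain v q where vq: "(p, a, v, q) \<in> trans A" by blast
    have q: "q \<in> states A" using vq tr by blast
    show "\<exists>!t. t \<in> trans B \<and> (\<exists>v q. t = (p', a, v, q))"
    proof (rule ex1I[of _ "(p', a, v, f q)"])
      show "(p', a, v, f q) \<in> trans B \<and> (\<exists>w s. (p', a, v, f q) = (p', a, w, s))"
        using trB[OF p(1) q] vq p(2) by simp
    next
      fix t assume "t \<in> trans B \<and> (\<exists>v q. t = (p', a, v, q))"
      then obtain w s where t: "t \<in> trans B" "t = (p', a, w, s)" by blast
      then have "s \<in> f ` states A" using tr by (auto simp: B_simps)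
      then obtain s' where s': "s' \<in> states A" "s = f s'" by blast
      then have "(p, a, w, s') \<in> trans A" using t p trB by simp
      with ex vq have "(p, a, w, s') = (p, a, v, q)" by blast
      then show "t = (p', a, v, f q)" using t s' by simp
    qed
  qed
  moreover have "weak_reset_language A = weak_reset_language B"
  proof (intro set_eqI)
    fix \<alpha>
    have "(\<exists>p v. is_run A \<alpha> p v \<and> weak_reset_accepting A p v) \<longleftrightarrow>
          (\<exists>p v. is_run B \<alpha> p v \<and> weak_reset_accepting B p v)" (is "?L \<longleftrightarrow> ?R")
    proof
      assume ?L
      then obtain p v where r: "is_run A \<alpha> p v" "weak_reset_accepting A p v" by blast
      have st: "p i \<in> states A" for i using r(1) tr by (auto simp: is_run_def)
      have "is_run B \<alpha> (f \<circ> p) v"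
        using r(1) st trB by (simp add: is_run_def B_simps(3))
      moreover have "weak_reset_accepting B (f \<circ> p) v"
        using r(2) st accB by (simp add: weak_reset_accepting_def B_simps(5))
      ultimately show ?R by blast
    next
      assume ?R
      then obtain p' v where r: "is_run B \<alpha> p' v" "weak_reset_accepting B p' v" by blast
      have "p' i \<in> f ` states A" for i
      proof -
        have "(p' i, \<alpha> i, v i, p' (Suc i)) \<in> trans B" using r(1) by (simp add: is_run_def)
        then show ?thesis using tr by (auto simp: B_simps)
      qed
      then have "\<forall>i. \<exists>s. s \<in> states A \<and> p' i = f s" by blast
      then obtain p where p: "\<And>i. p i \<in> states A" "\<And>i. p' i = f (p i)" by metis
      have "f (p 0) = f (init A)" using r(1) p by (simp add: is_run_def B_simps(3))
      then have "p 0 = init A" using inj p(1) init by (simp add: inj_on_eq_iff)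
      then have "is_run A \<alpha> p v" using r(1) p trB by (simp add: is_run_def)
      moreover have "weak_reset_accepting A p v"
        using r(2) p accB by (simp add: weak_reset_accepting_def B_simps(5))
      ultimately show ?L by blast
    qed
    then show "\<alpha> \<in> weak_reset_language A \<longleftrightarrow> \<alpha> \<in> weak_reset_language B"
      by (simp add: weak_reset_language_def B_simps(2))
  qed
  ultimately show ?thesis
    unfolding det_weak_reset_class_def using B_simps(2) by blast
qed

end

theory Submission
  imports Defs "HOL-Library.Omega_Words_Fun" "HOL-Library.Product_Plus"
begin

text \<open>
  If an accepting run on \<open>\<alpha>\<close> is reset after a prefix \<open>u\<close> and an accepting run on \<open>\<beta>\<close> is reset after a
  prefix \<open>v\<close>, both in the same state, then \<open>u\<close> followed by the remainder of \<open>\<beta>\<close> is accepted as well. For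
  the complement and the intersection this suffices, as there are words \<open>x\<^sub>0, x\<^sub>1, \<dots>\<close> in the language for
  which no splicing at late positions stays in the language: \<open>a\<^sup>n(b\<^sup>nc\<^sup>n)\<^sup>\<omega>\<close> if every prefix has to satisfy
  \<open>#c \<le> #b \<le> #c + #a\<close>, and \<open>(a\<^sup>n$$b\<^sup>n##)\<^sup>\<omega>\<close> for the intersection of two rendezvous languages, in which
  the separators \<open>##\<close> and \<open>$$\<close> fix the two rendezvous points.

  Nondeterministic automata are closed under union, so there determinism has to be used. A reset during
  a long run \<open>0\<^sup>N\<close> passes on the position of the rendezvous point in that run. The prefixes are chosen such
  that they lead to the same state for all possible positions \<open>x\<close>; then different \<open>x\<close> need different
  reset positions, and almost every position of the run has to serve some \<open>x\<close>. A segment containing the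
  whole run is no alternative: the words before and after it can be exchanged without changing the
  vector sum, and this moves the run away from the rendezvous point. But the second language, of
  words \<open>u0\<^sup>\<omega>\<close> with fewer letters \<open>2\<close> than \<open>3\<close> in \<open>u\<close>, requires reset states in each period of the run as
  well from which \<open>0\<^sup>\<omega>\<close> is accepted, and their positions cannot serve any \<open>x\<close>. Counting positions yields a contradiction.
\<close>

section \<open>Words and counting\<close>

lemma omega_words_conc:
  "u \<frown> \<alpha> \<in> omega_words \<Sigma> \<longleftrightarrow> set u \<subseteq> \<Sigma> \<and> \<alpha> \<in> omega_words \<Sigma>"
proof -
  have "\<beta> \<in> omega_words \<Sigma> \<longleftrightarrow> range \<beta> \<subseteq> \<Sigma>" for \<beta> by (auto simp: omega_words_def)
  then show ?thesis by simp
qed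

lemma omega_words_iter:
  assumes "xs \<noteq> []" "set xs \<subseteq> \<Sigma>"
  shows "xs\<^sup>\<omega> \<in> omega_words \<Sigma>"
proof -
  have "xs ! (i mod length xs) \<in> set xs" for i
    by (rule nth_mem) (use assms(1) in simp)
  then show ?thesis using assms by (auto simp: omega_words_def)
qed

lemma count_list_replicate: "count_list (replicate n a) b = (if a = b then n else 0)"
  by (induction n) auto

lemma count_list_concat_replicate: "count_list (concat (replicate n xs)) a = n * count_list xs a"
  by (induction n) auto

lemma iter_unroll_replicate: "xs \<noteq> [] \<Longrightarrow> xs\<^sup>\<omega> = concat (replicate n xs) \<frown> xs\<^sup>\<omega>"
proof (induction n)
  case (Suc n)
  then have "xs\<^sup>\<omega> = xs \<frown> concat (replicate n xs) \<frown> xs\<^sup>\<omega>"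
    using iter_unroll[of xs] by (metis length_greater_0_conv)
  then show ?case by (simp only: conc_conc replicate_Suc concat.simps)
qed simp

lemma length_concat_replicate: "length (concat (replicate n xs)) = n * length xs"
  by (induction n) auto

lemma prefix_iter:
  assumes "xs \<noteq> []"
  shows "prefix k (xs\<^sup>\<omega>) = concat (replicate (k div length xs) xs) @ take (k mod length xs) xs"
proof -
  let ?c = "concat (replicate (k div length xs) xs)"
  have le: "length ?c \<le> k" and d: "k - length ?c = k mod length xs"
    by (simp_all add: length_concat_replicate minus_div_mult_eq_mod)
  have "prefix k (xs\<^sup>\<omega>) = prefix k (?c \<frown> xs\<^sup>\<omega>)"
    using iter_unroll_replicate[OF assms] by metis
  also have "\<dots> = ?c @ prefix (k mod length xs) (xs\<^sup>\<omega>)"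
    unfolding prefix_conc_snd[OF le] d ..
  also have "prefix (k mod length xs) (xs\<^sup>\<omega>) = prefix (k mod length xs) (xs \<frown> xs\<^sup>\<omega>)"
    using iter_unroll[of xs] assms by simp
  also have "\<dots> = take (k mod length xs) xs"
    by (rule prefix_conc_fst) (use assms in \<open>simp add: order_less_imp_le\<close>)
  finally show ?thesis .
qed

lemma suffix_iter:
  assumes "xs \<noteq> []"
  shows "suffix k (xs\<^sup>\<omega>) = drop (k mod length xs) xs \<frown> xs\<^sup>\<omega>"
proof -
  let ?c = "concat (replicate (k div length xs) xs)"
  have le: "length ?c \<le> k" and d: "k - length ?c = k mod length xs"
    by (simp_all add: length_concat_replicate minus_div_mult_eq_mod)
  have "suffix k (xs\<^sup>\<omega>) = suffix k (?c \<frown> xs\<^sup>\<omega>)"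
    using iter_unroll_replicate[OF assms] by metis
  also have "\<dots> = suffix (k mod length xs) (xs\<^sup>\<omega>)"
    unfolding suffix_conc_snd[OF le] d ..
  also have "\<dots> = suffix (k mod length xs) (xs \<frown> xs\<^sup>\<omega>)"
    using iter_unroll[of xs] assms by simp
  also have "\<dots> = drop (k mod length xs) xs \<frown> xs\<^sup>\<omega>"
    by (rule suffix_conc_fst) (use assms in \<open>simp add: order_less_imp_le\<close>)
  finally show ?thesis .
qed

lemma iter_split:
  assumes "u @ w = xs" "w \<noteq> []"
  shows "xs\<^sup>\<omega> = (concat (replicate n xs) @ u) \<frown> w \<frown> xs\<^sup>\<omega>"
proof -
  have xs: "xs \<noteq> []" using assms by auto
  have "xs\<^sup>\<omega> = concat (replicate n xs) \<frown> xs \<frown> xs\<^sup>\<omega>"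
    using iter_unroll_replicate[OF xs, of n] iter_unroll[of xs] xs by simp
  then show ?thesis using assms(1) by (metis conc_conc append_assoc)
qed

lemma conc_eq_append:
  assumes "u \<frown> \<alpha> = v \<frown> \<beta>" "length u \<le> length v"
  shows "\<exists>w. v = u @ w \<and> \<alpha> = w \<frown> \<beta>"
proof -
  have "prefix (length u) (v \<frown> \<beta>) = u" using assms(1) by (metis prefix_conc_length)
  then have "v = u @ drop (length u) v" using assms(2) by (metis append_take_drop_id prefix_conc_fst)
  moreover from this have "\<alpha> = drop (length u) v \<frown> \<beta>"
    using assms(1) by (metis conc_conc same_concat_eq)
  ultimately show ?thesis by blast
qed

text \<open>Counting \<open>h\<close> locates the end of \<open>u\<close>: a \<open>u\<close>
  shorter than \<open>p\<close> would miss the last letter \<open>h\<close> of \<open>p\<close>, and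
  a \<open>u\<close> reaching beyond \<open>b\<close> would contain the next
  \<open>h\<close>.\<close>

lemma conc_block:
  assumes "u \<frown> \<alpha> = p \<frown> (b @ [h]) \<frown> \<beta>" "count_list u h = count_list p h"
    "h \<notin> set b" "p = [] \<or> last p = h"
  shows "\<exists>w z. u = p @ w \<and> b = w @ z"
proof -
  have "length p \<le> length u"
  proof (rule ccontr)
    assume "\<not> length p \<le> length u"
    then obtain w where w: "p = u @ w" using conc_eq_append[OF assms(1)] by (meson nat_le_linear)
    with \<open>\<not> length p \<le> length u\<close> have "w \<noteq> []" by auto
    then have "last w = h" "p \<noteq> []" using assms(4) w by auto
    then have "h \<in> set w" using \<open>w \<noteq> []\<close> last_in_set by metis
    then show False using assms(2) w by (simp add: count_list_0_iff)
  qed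
  then obtain w where w: "u = p @ w" "(b @ [h]) \<frown> \<beta> = w \<frown> \<alpha>"
    using conc_eq_append[OF assms(1)[symmetric]] by blast
  have "length w \<le> length b"
  proof (rule ccontr)
    assume "\<not> length w \<le> length b"
    then obtain y where "w = (b @ [h]) @ y"
      using conc_eq_append[OF w(2)] by (auto simp del: conc_conc)
    then show False using assms(2) w(1) by simp
  qed
  then obtain z where z: "b @ [h] = w @ z"
    using conc_eq_append[OF w(2)[symmetric]] by auto
  with \<open>length w \<le> length b\<close> have "z \<noteq> []" by auto
  with z have "b = w @ butlast z" by (metis butlast_append butlast_snoc)
  then show ?thesis using w(1) by blast
qed

lemma append_eq_cases:
  assumes "w @ z = a @ b"
  shows "(\<exists>w'. a = w @ w') \<or> (\<exists>w'. w = a @ w' \<and> b = w' @ z)"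
  using assms by (auto simp: append_eq_append_conv2)

lemma append3_eq_cases:
  assumes "w @ z = a @ b @ c"
  obtains w' where "a = w @ w'"
  | w' w'' where "w = a @ w'" "b = w' @ w''"
  | w' where "w = a @ b @ w'" "c = w' @ z"
proof -
  consider "\<exists>w'. a = w @ w'" | v where "w = a @ v" "v @ z = b @ c"
    using append_eq_cases[OF assms] by auto
  then show thesis
  proof cases
    case 2
    from append_eq_cases[OF 2(2)] 2(1) show thesis using that(2,3) by blast
  qed (use that(1) in blast)
qed

text \<open>By pigeonhole the orbit of \<open>q\<close> has a preperiod and a period of at most
  \<open>card Q\<close>. The factorial bounds the former and is a multiple of the latter, so one
  modulus serves every map and every starting point.\<close>

lemma funpow_fact_eq:
  assumes fin: "finite Q" and closed: "\<And>q. q \<in> Q \<Longrightarrow> f q \<in> Q" and q: "q \<in> Q"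
    and le: "fact (card Q) \<le> a" "fact (card Q) \<le> b" and cong: "a mod fact (card Q) = b mod fact (card Q)"
  shows "(f ^^ a) q = (f ^^ b) q"
proof -
  let ?L = "fact (card Q) :: nat"
  have inQ: "(f ^^ n) q \<in> Q" for n by (induction n) (use closed q in auto)
  have "\<not> inj_on (\<lambda>n. (f ^^ n) q) {..card Q}"
  proof
    assume "inj_on (\<lambda>n. (f ^^ n) q) {..card Q}"
    then have "card {..card Q} \<le> card Q"
      by (rule card_inj_on_le) (use inQ fin in auto)
    then show False by simp
  qed
  then obtain i j where ij: "i < j" "j \<le> card Q" "(f ^^ i) q = (f ^^ j) q"
    unfolding inj_on_def by (metis atMost_iff linorder_neqE_nat)
  define p where "p = j - i"
  have period: "(f ^^ (n + p)) q = (f ^^ n) q" if "i \<le> n" for n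
  proof -
    have "(f ^^ (n + p)) q = (f ^^ (n - i)) ((f ^^ j) q)"
      using that ij(1) by (simp add: p_def flip: funpow_add[unfolded comp_def, THEN fun_cong])
    also have "\<dots> = (f ^^ (n - i)) ((f ^^ i) q)" by (simp add: ij(3))
    also have "\<dots> = (f ^^ n) q"
      using that by (simp flip: funpow_add[unfolded comp_def, THEN fun_cong])
    finally show ?thesis .
  qed
  have periods: "(f ^^ (n + t * p)) q = (f ^^ n) q" if "i \<le> n" for n t
  proof (induction t)
    case (Suc t)
    then show ?case using period[of "n + t * p"] that by (simp add: algebra_simps)
  qed simp
  have "p dvd ?L" unfolding p_def using ij by (intro dvd_fact) auto
  then obtain d where d: "?L = p * d" by (elim dvdE)
  have i: "i \<le> ?L" using ij fact_ge_self[of "card Q"] by linarith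
  have wlog: "(f ^^ n) q = (f ^^ m) q" if nm: "n \<le> m" "?L \<le> n" "n mod ?L = m mod ?L" for n m
  proof -
    obtain c where "m = n + ?L * c" using nm by (metis mod_eq_dvd_iff_nat dvdE le_add_diff_inverse)
    then have "m = n + (d * c) * p" by (simp add: d algebra_simps)
    then show ?thesis using periods[of n "d * c"] nm i by simp
  qed
  show ?thesis using wlog[of a b] wlog[of b a] le cong by (metis nat_le_linear)
qed

section \<open>Machines with nondeterministic resets\<close>

text \<open>Once the run is given by total functions, the only choice left is where to reset.
  Acceptance is considered from an arbitrary state, because after a reset the run continues like a
  fresh one.\<close>

locale reset_machine =
  fixes step :: "'q \<Rightarrow> 'a \<Rightarrow> 'q" and wt :: "'q \<Rightarrow> 'a \<Rightarrow> nvec"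
    and final :: "'q set" and good :: "nvec set"
begin

abbreviation run :: "'q \<Rightarrow> 'a list \<Rightarrow> 'q" where
  "run \<equiv> foldl step"

fun weight :: "'q \<Rightarrow> 'a list \<Rightarrow> nvec" where
  "weight q [] = (\<lambda>_. 0)"
| "weight q (a # xs) = (\<lambda>j. wt q a j + weight (step q a) xs j)"

lemma weight_append: "weight q (xs @ ys) = (\<lambda>j. weight q xs j + weight (run q xs) ys j)"
  by (induction xs arbitrary: q) (auto simp: fun_eq_iff)

definition chain :: "'q \<Rightarrow> 'a word \<Rightarrow> (nat \<Rightarrow> nat) \<Rightarrow> bool" where
  "chain q \<alpha> k \<longleftrightarrow> k 0 = 0 \<and> strict_mono k \<and>
     (\<forall>i. run q (prefix (k (Suc i)) \<alpha>) \<in> final \<and>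
          weight (run q (prefix (k i) \<alpha>)) (\<alpha> [k i \<rightarrow> k (Suc i)]) \<in> good)"

definition accepts :: "'q \<Rightarrow> 'a word \<Rightarrow> bool" where
  "accepts q \<alpha> \<longleftrightarrow> (\<exists>k. chain q \<alpha> k)"

text \<open>
  A prefix of length \<open>m\<close> is a cut if the run may be reset there: acceptance of a continuation then
  depends only on the state that has been reached. Hence two words may be spliced at cuts with equal
  states.
\<close>

definition cut :: "'q \<Rightarrow> 'a word \<Rightarrow> nat \<Rightarrow> bool" where
  "cut q \<alpha> m \<longleftrightarrow> accepts (run q (prefix m \<alpha>)) (suffix m \<alpha>) \<and>
     (\<forall>\<beta>. accepts (run q (prefix m \<alpha>)) \<beta> \<longrightarrow> accepts q (prefix m \<alpha> \<frown> \<beta>))"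

lemma cut_splice:
  assumes "cut q \<alpha> m" "cut q \<beta> n" "run q (prefix m \<alpha>) = run q (prefix n \<beta>)"
  shows "accepts q (prefix m \<alpha> \<frown> suffix n \<beta>)"
  using assms by (auto simp: cut_def)

lemma prefix_add: "prefix (m + n) \<alpha> = prefix m \<alpha> @ prefix n (suffix m \<alpha>)"
  by (simp add: subsequence_append)

text \<open>Weights start afresh at a reset. So the resets from the \<open>i\<close>-th on, shifted,
  form a chain for the remainder, and the chain of any other continuation can be glued to the first
  \<open>i\<close> resets.\<close>

lemma chain_cut:
  assumes "chain q \<alpha> k"
  shows "cut q \<alpha> (k i)"
  unfolding cut_def
proof (intro conjI allI impI)
  have k0: "k 0 = 0" and mono: "strict_mono k"
    and fin: "\<And>i. run q (prefix (k (Suc i)) \<alpha>) \<in> final"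
    and gd: "\<And>i. weight (run q (prefix (k i) \<alpha>)) (\<alpha> [k i \<rightarrow> k (Suc i)]) \<in> good"
    using assms by (auto simp: chain_def)
  have le: "k i \<le> k (i + j)" for j using mono by (simp add: strict_mono_less_eq)
  let ?q = "run q (prefix (k i) \<alpha>)"
  have pre: "run ?q (prefix (k (i + j) - k i) (suffix (k i) \<alpha>)) = run q (prefix (k (i + j)) \<alpha>)" for j
    using prefix_add[of \<alpha> "k i" "k (i + j) - k i"] le[of j] by simp
  have "chain ?q (suffix (k i) \<alpha>) (\<lambda>j. k (i + j) - k i)"
    unfolding chain_def pre
  proof (intro conjI allI)
    show "strict_mono (\<lambda>j. k (i + j) - k i)"
    proof (rule strict_monoI)
      fix x y :: nat assume "x < y"
      then have "k (i + x) < k (i + y)" using mono by (simp add: strict_mono_less)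
      then show "k (i + x) - k i < k (i + y) - k i" using le[of x] by simp
    qed
    fix j
    show "run q (prefix (k (i + Suc j)) \<alpha>) \<in> final" using fin[of "i + j"] by simp
    show "weight (run q (prefix (k (i + j)) \<alpha>))
       (suffix (k i) \<alpha> [k (i + j) - k i \<rightarrow> k (i + Suc j) - k i]) \<in> good"
      using gd[of "i + j"] le[of j] le[of "Suc j"] by simp
  qed simp
  then show "accepts ?q (suffix (k i) \<alpha>)" by (auto simp: accepts_def)
  fix \<beta> assume "accepts ?q \<beta>"
  then obtain l where l: "chain ?q \<beta> l" by (auto simp: accepts_def)
  have l0: "l 0 = 0" and lmono: "strict_mono l"
    and lfin: "\<And>i. run ?q (prefix (l (Suc i)) \<beta>) \<in> final"
    and lgd: "\<And>i. weight (run ?q (prefix (l i) \<beta>)) (\<beta> [l i \<rightarrow> l (Suc i)]) \<in> good"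
    using l by (auto simp: chain_def)
  let ?\<gamma> = "prefix (k i) \<alpha> \<frown> \<beta>"
  define h where "h j = (if j \<le> i then k j else k i + l (j - i))" for j
  have lo: "prefix (k j) ?\<gamma> = prefix (k j) \<alpha>" if "j \<le> i" for j
    using that mono by (simp add: strict_mono_less_eq min_absorb2)
  have "chain q ?\<gamma> h"
    unfolding chain_def
  proof (intro conjI allI)
    show "h 0 = 0" by (simp add: h_def k0)
    have "h j < h (Suc j)" for j
    proof -
      consider "Suc j \<le> i" | "j = i" | "i < j" by linarith
      then show ?thesis
      proof cases
        case 1
        then show ?thesis using mono by (simp add: h_def strict_mono_less)
      next
        case 2
        then show ?thesis using strict_monoD[OF lmono, of 0 1] by (simp add: h_def l0)
      next
        case 3
        then have "l (j - i) < l (Suc j - i)" using lmono by (simp add: strict_mono_less)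
        then show ?thesis using 3 by (simp add: h_def)
      qed
    qed
    then show "strict_mono h" by (simp add: strict_mono_Suc_iff)
    fix j
    show "run q (prefix (h (Suc j)) ?\<gamma>) \<in> final"
    proof (cases "Suc j \<le> i")
      case True
      then show ?thesis using lo[of "Suc j"] fin[of j] by (simp add: h_def)
    next
      case False
      then have "Suc j - i = Suc (j - i)" by simp
      then show ?thesis using False lfin[of "j - i"] by (simp add: h_def)
    qed
    show "weight (run q (prefix (h j) ?\<gamma>)) (?\<gamma> [h j \<rightarrow> h (Suc j)]) \<in> good"
    proof (cases "Suc j \<le> i")
      case True
      have "?\<gamma> [k j \<rightarrow> k (Suc j)] = drop (k j) (prefix (k (Suc j)) ?\<gamma>)" by simp
      also have "\<dots> = \<alpha> [k j \<rightarrow> k (Suc j)]" unfolding lo[OF True] by simp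
      finally show ?thesis using True lo[of j] gd[of j] by (simp add: h_def)
    next
      case False
      then have e: "Suc j - i = Suc (j - i)" and ij: "i \<le> j" by simp_all
      have hj: "h j = k i + l (j - i)" using ij by (cases "i = j") (simp_all add: h_def l0)
      have hs: "h (Suc j) = k i + l (Suc (j - i))" using False e by (simp add: h_def)
      have "?\<gamma> [h j \<rightarrow> h (Suc j)] = \<beta> [l (j - i) \<rightarrow> l (Suc (j - i))]"
        unfolding hj hs
        by (metis length_map length_upt diff_zero subsequence_def suffix_conc_length subsequence_shift)
      moreover have "run q (prefix (h j) ?\<gamma>) = run ?q (prefix (l (j - i)) \<beta>)"
        unfolding hj by simp
      ultimately show ?thesis using lgd[of "j - i"] by simp
    qed
  qed
  then show "accepts q ?\<gamma>" by (auto simp: accepts_def)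
qed

lemma accepts_cuts:
  assumes "accepts q \<alpha>"
  shows "\<exists>m\<ge>n. cut q \<alpha> m"
proof -
  obtain k where k: "chain q \<alpha> k" using assms by (auto simp: accepts_def)
  then have "n \<le> k n" by (simp add: chain_def strict_mono_imp_increasing)
  then show ?thesis using chain_cut[OF k] by blast
qed

text \<open>If no reset falls strictly inside \<open>ys\<close>, every segment contains this block
  completely or avoids it. A block of the same length, target state and weight then changes neither
  the states at the resets nor the segment weights, and the old chain still works.\<close>

lemma replace_or_cut:
  assumes acc: "accepts q (xs \<frown> ys \<frown> \<beta>)" and len: "length ys' = length ys"
    and st: "run (run q xs) ys' = run (run q xs) ys"
    and w: "weight (run q xs) ys' = weight (run q xs) ys"
  shows "accepts q (xs \<frown> ys' \<frown> \<beta>) \<or>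
    (\<exists>m. length xs < m \<and> m < length xs + length ys \<and> cut q (xs \<frown> ys \<frown> \<beta>) m)"
proof -
  let ?\<alpha> = "xs \<frown> ys \<frown> \<beta>" and ?\<alpha>' = "xs \<frown> ys' \<frown> \<beta>"
  let ?a = "length xs" and ?b = "length xs + length ys"
  obtain k where k: "chain q ?\<alpha> k" using acc by (auto simp: accepts_def)
  have "accepts q ?\<alpha>'" if no: "\<And>i. \<not> (?a < k i \<and> k i < ?b)"
  proof -
    have lo: "prefix n ?\<alpha>' = prefix n ?\<alpha>" if "n \<le> ?a" for n
      using that len by simp
    have hi: "prefix n ?\<alpha>' = xs @ ys' @ prefix (n - ?b) \<beta>"
      "prefix n ?\<alpha> = xs @ ys @ prefix (n - ?b) \<beta>" if "?b \<le> n" for n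
      using that len by simp_all
    have runs: "run q (prefix n ?\<alpha>') = run q (prefix n ?\<alpha>)" if "n \<le> ?a \<or> ?b \<le> n" for n
      using that
    proof
      assume "?b \<le> n" then show ?thesis by (simp only: hi foldl_append st)
    qed (simp only: lo)
    have seg: "drop m (prefix n \<gamma>) = \<gamma> [m \<rightarrow> n]" for m n and \<gamma> :: "'a word" by simp
    have weights: "weight (run q (prefix m ?\<alpha>')) (?\<alpha>' [m \<rightarrow> n]) =
        weight (run q (prefix m ?\<alpha>)) (?\<alpha> [m \<rightarrow> n])"
      if mn: "m \<le> n" "m \<le> ?a \<or> ?b \<le> m" "n \<le> ?a \<or> ?b \<le> n" for m n
    proof -
      consider "n \<le> ?a" | "m \<le> ?a" "?b \<le> n" | "?b \<le> m" using mn by linarith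
      then show ?thesis
      proof cases
        case 1
        then have "?\<alpha>' [m \<rightarrow> n] = ?\<alpha> [m \<rightarrow> n]"
          using lo[of n] by (metis seg)
        then show ?thesis using runs[of m] 1 mn(1) by simp
      next
        case 2
        have d: "?\<alpha>' [m \<rightarrow> n] = drop m xs @ ys' @ prefix (n - ?b) \<beta>"
          "?\<alpha> [m \<rightarrow> n] = drop m xs @ ys @ prefix (n - ?b) \<beta>"
          unfolding seg[of m ?\<alpha>' n, symmetric] seg[of m ?\<alpha> n, symmetric] hi[OF 2(2)]
          using 2(1) by simp_all
        have p: "prefix m ?\<alpha>' = take m xs" "prefix m ?\<alpha> = take m xs"
          using 2 by simp_all
        have "run (run q (take m xs)) (drop m xs) = run q xs"
          by (metis append_take_drop_id foldl_append)
        then show ?thesis by (simp only: d p weight_append w st)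
      next
        case 3
        then have "drop m (prefix n ?\<alpha>') = drop m (prefix n ?\<alpha>)"
          using mn(1) len hi[of n] by (simp del: subsequence_drop prefix_conc_snd conc_conc)
        then show ?thesis using runs[of m] 3 by (metis seg)
      qed
    qed
    have kle: "k i \<le> k (Suc i)" for i using k by (simp add: chain_def strict_mono_less_eq)
    have out: "k i \<le> ?a \<or> ?b \<le> k i" for i using no[of i] by linarith
    have "chain q ?\<alpha>' k"
      unfolding chain_def
    proof (intro conjI allI)
      fix i
      show "run q (prefix (k (Suc i)) ?\<alpha>') \<in> final"
        unfolding runs[OF out] using k unfolding chain_def by blast
      show "weight (run q (prefix (k i) ?\<alpha>')) (?\<alpha>' [k i \<rightarrow> k (Suc i)]) \<in> good"
        using k unfolding weights[OF kle[of i] out[of i] out[of "Suc i"]] chain_def by blast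
    qed (use k in \<open>simp_all add: chain_def\<close>)
    then show ?thesis by (auto simp: accepts_def)
  qed
  then show ?thesis using chain_cut[OF k] by blast
qed

end

section \<open>Deterministic Parikh automata as reset machines\<close>

lemma (in reset_machine) run_closed:
  assumes "\<And>q a. \<lbrakk>q \<in> Q; a \<in> \<Sigma>\<rbrakk> \<Longrightarrow> step q a \<in> Q" "q \<in> Q" "set xs \<subseteq> \<Sigma>"
  shows "run q xs \<in> Q"
  using assms(2,3) by (induction xs arbitrary: q) (auto simp: assms(1))

context reset_machine
begin

lemma vec_sum_run:
  assumes "m \<le> n"
  shows "vec_sum (\<lambda>i. wt (run q (prefix i \<alpha>)) (\<alpha> i)) m n =
    weight (run q (prefix m \<alpha>)) (\<alpha> [m \<rightarrow> n])"
  using assms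
proof (induction n rule: dec_induct)
  case base
  then show ?case by (simp add: vec_sum_def)
next
  case (step i)
  have "prefix i \<alpha> = prefix m \<alpha> @ \<alpha> [m \<rightarrow> i]"
    using subsequence_append[of \<alpha> m "i - m"] step by simp
  then have "run (run q (prefix m \<alpha>)) (\<alpha> [m \<rightarrow> i]) = run q (prefix i \<alpha>)" by simp
  then show ?case
    using step by (auto simp: vec_sum_def weight_append fun_eq_iff)
qed

text \<open>The run on a word over the alphabet is unique, so the quantifier over runs collapses to
  the run computed by \<open>step\<close> and \<open>wt\<close>; only the reset positions remain
  existential.\<close>

lemma language_accepts:
  assumes pa: "parikh_automaton A"
    and tr: "\<And>q a v q'. \<lbrakk>q \<in> states A; a \<in> alphabet A\<rbrakk> \<Longrightarrow>
      (q, a, v, q') \<in> trans A \<longleftrightarrow> v = wt q a \<and> q' = step q a"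
    and fin: "final = acc A" and good: "good = constr A"
  shows "weak_reset_language A = {\<alpha> \<in> omega_words (alphabet A). accepts (init A) \<alpha>}"
proof -
  have "(\<exists>p v. is_run A \<alpha> p v \<and> weak_reset_accepting A p v) \<longleftrightarrow> accepts (init A) \<alpha>"
    if \<alpha>: "\<alpha> \<in> omega_words (alphabet A)" for \<alpha>
  proof -
    define p0 where "p0 i = run (init A) (prefix i \<alpha>)" for i
    define v0 where "v0 i = wt (p0 i) (\<alpha> i)" for i
    have letter: "\<alpha> i \<in> alphabet A" for i using \<alpha> by (simp add: omega_words_def)
    have init: "init A \<in> states A" and sub: "trans A \<subseteq> states A \<times> alphabet A \<times> nvecs (dim A) \<times> states A"
      using pa by (auto simp: parikh_automaton_def)
    have p0s: "p0 (Suc i) = step (p0 i) (\<alpha> i)" for i by (simp add: p0_def)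
    have p0st: "p0 i \<in> states A" for i
    proof (induction i)
      case (Suc i)
      have "(p0 i, \<alpha> i, wt (p0 i) (\<alpha> i), step (p0 i) (\<alpha> i)) \<in> trans A"
        using tr[OF Suc letter] by simp
      then show ?case using sub p0s by auto
    qed (simp add: p0_def init)
    have run: "is_run A \<alpha> p v \<longleftrightarrow> p = p0 \<and> v = v0" for p v
    proof
      assume r: "is_run A \<alpha> p v"
      then have e: "p 0 = init A" "\<And>i. (p i, \<alpha> i, v i, p (Suc i)) \<in> trans A"
        by (auto simp: is_run_def)
      have "p i = p0 i" for i
      proof (induction i)
        case (Suc i)
        then show ?case using e(2)[of i] tr[OF p0st letter] p0s by simp
      qed (simp add: e p0_def)
      moreover from this have "v i = v0 i" for i
        using e(2)[of i] tr[OF p0st letter] by (simp add: v0_def)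
      ultimately show "p = p0 \<and> v = v0" by auto
    qed (use tr[OF p0st letter] p0s in \<open>simp add: is_run_def v0_def p0_def\<close>)
    have vs: "vec_sum v0 m n = weight (p0 m) (\<alpha> [m \<rightarrow> n])" if "m \<le> n" for m n
      using vec_sum_run[OF that, of "init A" \<alpha>] by (simp add: v0_def[abs_def] p0_def)
    have "weak_reset_accepting A p0 v0 \<longleftrightarrow> (\<exists>k. k 0 = 0 \<and> strict_mono k \<and>
        (\<forall>i. p0 (k (Suc i)) \<in> final \<and> vec_sum v0 (k i) (k (Suc i)) \<in> good))"
      (is "_ \<longleftrightarrow> (\<exists>k. ?P k)")
      unfolding weak_reset_accepting_def fin good
      by (rule ex_cong1, rule conj_cong, rule refl, rule conj_cong, rule refl)
         (metis One_nat_def Suc_le_D diff_Suc_1 le_add1 plus_1_eq_Suc)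
    also have "\<dots> \<longleftrightarrow> (\<exists>k. chain (init A) \<alpha> k)"
      by (rule ex_cong1) (auto simp: chain_def p0_def[symmetric] vs strict_mono_less_eq)
    finally show ?thesis by (simp add: run accepts_def)
  qed
  then show ?thesis by (auto simp: weak_reset_language_def)
qed

end

text \<open>\<open>step\<close> and \<open>wt\<close> are read off by choice, which is forced on
  pairs of a state and a letter; elsewhere the values are arbitrary. Hence the closure condition on
  \<open>Q\<close>.\<close>

lemma det_weak_reset_class_machine:
  assumes "L \<in> det_weak_reset_class \<Sigma>"
  obtains Q :: "nat set" and step wt final good s
  where "finite Q" "s \<in> Q" "\<And>q a. \<lbrakk>q \<in> Q; a \<in> \<Sigma>\<rbrakk> \<Longrightarrow> step q a \<in> Q"
    "L = {\<alpha> \<in> omega_words \<Sigma>. reset_machine.accepts step wt final good s \<alpha>}"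
proof -
  obtain A :: "(nat, 'a) pa" where A: "L = weak_reset_language A" "parikh_automaton A"
    "deterministic A" "alphabet A = \<Sigma>"
    using assms by (auto simp: det_weak_reset_class_def)
  define step where "step q a = (SOME q'. \<exists>v. (q, a, v, q') \<in> trans A)" for q a
  define wt where "wt q a = (SOME v. \<exists>q'. (q, a, v, q') \<in> trans A)" for q a
  have tr: "(q, a, v, q') \<in> trans A \<longleftrightarrow> v = wt q a \<and> q' = step q a"
    if q: "q \<in> states A" "a \<in> alphabet A" for q a v q'
  proof -
    have "\<exists>!t. t \<in> trans A \<and> (\<exists>v q'. t = (q, a, v, q'))"
      using A(3) q by (auto simp: deterministic_def)
    then obtain v0 q0 where u: "\<And>v q'. (q, a, v, q') \<in> trans A \<longleftrightarrow> v = v0 \<and> q' = q0"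
      by (metis (no_types, lifting) prod.inject)
    then show ?thesis by (simp add: step_def wt_def)
  qed
  have sub: "trans A \<subseteq> states A \<times> alphabet A \<times> nvecs (dim A) \<times> states A"
    using A(2) by (auto simp: parikh_automaton_def)
  show thesis
  proof (rule that[of "states A" "init A" step wt "acc A" "constr A"])
    show "step q a \<in> states A" if "q \<in> states A" "a \<in> \<Sigma>" for q a
    proof -
      have "(q, a, wt q a, step q a) \<in> trans A" using tr that A(4) by simp
      then show ?thesis using sub by auto
    qed
    show "L = {\<alpha> \<in> omega_words \<Sigma>. reset_machine.accepts step wt (acc A) (constr A) (init A) \<alpha>}"
      unfolding A(1) A(4)[symmetric]
      by (rule reset_machine.language_accepts[OF A(2) tr]) auto
  qed (use A(2) in \<open>auto simp: parikh_automaton_def\<close>)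
qed

text \<open>Choose in each \<open>x n\<close> a cut at or beyond \<open>B n\<close>. As there are
  only finitely many states, two of these cuts share a state, and the words can be spliced there.
  The bound keeps the splice behind a prescribed initial part.\<close>

lemma fooling:
  fixes x :: "nat \<Rightarrow> 'a word"
  assumes "L \<in> det_weak_reset_class \<Sigma>" and x: "\<And>n. x n \<in> L"
  obtains n n' i j where "n < n'" "B n \<le> i" "B n' \<le> j"
    "prefix i (x n) \<frown> suffix j (x n') \<in> L"
proof -
  obtain Q :: "nat set" and step wt final good s
    where Q: "finite Q" "s \<in> Q" "\<And>q a. \<lbrakk>q \<in> Q; a \<in> \<Sigma>\<rbrakk> \<Longrightarrow> step q a \<in> Q"
      and L: "L = {\<alpha> \<in> omega_words \<Sigma>. reset_machine.accepts step wt final good s \<alpha>}"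
    using assms(1) by (rule det_weak_reset_class_machine) (rule that)
  interpret reset_machine step wt final good .
  have xo: "x n i \<in> \<Sigma>" for n i using x[of n] by (simp add: L omega_words_def)
  have "\<exists>m. B n \<le> m \<and> cut s (x n) m" for n
    using accepts_cuts[of s "x n" "B n"] x[of n] by (auto simp: L)
  then obtain m where m: "\<And>n. B n \<le> m n" "\<And>n. cut s (x n) (m n)" by metis
  define st where "st n = run s (prefix (m n) (x n))" for n
  have "st n \<in> Q" for n
    unfolding st_def by (rule run_closed[of Q \<Sigma>]) (use Q xo in auto)
  then have "finite (range st)" using Q(1) by (meson finite_subset image_subsetI)
  then have "\<not> inj st" by (meson finite_imageD infinite_UNIV_nat)
  then obtain n n' where n: "n < n'" "st n = st n'"
    unfolding inj_def by (metis nat_neq_iff)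
  have "accepts s (prefix (m n) (x n) \<frown> suffix (m n') (x n'))"
    using cut_splice[OF m(2) m(2)] n(2) by (simp add: st_def)
  moreover have "prefix (m n) (x n) \<frown> suffix (m n') (x n') \<in> omega_words \<Sigma>"
    using xo by (auto simp: omega_words_def conc_def)
  ultimately have "prefix (m n) (x n) \<frown> suffix (m n') (x n') \<in> L" by (simp add: L)
  then show thesis by (rule that[OF n(1) m(1) m(1)])
qed

section \<open>Semilinear sets\<close>

lemma nvecs_mono: "m \<le> n \<Longrightarrow> nvecs m \<subseteq> nvecs n"
  by (auto simp: nvecs_def)

lemma lin_comb_subset:
  assumes "b \<in> nvecs n" "P \<subseteq> nvecs n"
  shows "lin_comb b P \<subseteq> nvecs n"
proof -
  have "(\<Sum>p\<in>P. p j * z p) = 0" if "n \<le> j" for z :: "nvec \<Rightarrow> nat" and j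
    by (rule sum.neutral) (use assms that in \<open>auto simp: nvecs_def\<close>)
  then show ?thesis using assms by (auto simp: lin_comb_def nvecs_def)
qed

lemma semilinear_set_subset:
  assumes "semilinear_set n S"
  shows "S \<subseteq> nvecs n"
proof -
  have "L \<subseteq> nvecs n" if "linear_set n L" for L
    using that lin_comb_subset by (auto simp: linear_set_def)
  then show ?thesis using assms by (auto simp: semilinear_set_def)
qed

lemma semilinear_set_Un:
  assumes "semilinear_set n S" "semilinear_set n T"
  shows "semilinear_set n (S \<union> T)"
proof -
  obtain \<L> \<M> where "finite \<L>" "\<forall>L\<in>\<L>. linear_set n L" "S = \<Union>\<L>"
    "finite \<M>" "\<forall>L\<in>\<M>. linear_set n L" "T = \<Union>\<M>"
    using assms by (auto simp: semilinear_set_def)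
  then show ?thesis
    unfolding semilinear_set_def by (intro exI[of _ "\<L> \<union> \<M>"]) auto
qed

lemma semilinear_set_Suc:
  assumes "semilinear_set n S"
  shows "semilinear_set (Suc n) S"
proof -
  have "linear_set (Suc n) L" if L: "linear_set n L" for L
  proof -
    obtain b P where "b \<in> nvecs n" "finite P" "P \<subseteq> nvecs n" "L = lin_comb b P"
      using L by (auto simp: linear_set_def)
    then show ?thesis
      unfolding linear_set_def using nvecs_mono[of n "Suc n"] by (intro exI[of _ b] exI[of _ P]) auto
  qed
  then show ?thesis using assms by (auto simp: semilinear_set_def)
qed

text \<open>Adding a constant to one coordinate only moves the base vectors; the periods
  stay.\<close>

lemma semilinear_set_flag:
  assumes "semilinear_set n S"
  shows "semilinear_set (Suc n) ((\<lambda>v. v(n := Suc (v n))) ` S)"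
proof -
  obtain \<L> where \<L>: "finite \<L>" "\<And>L. L \<in> \<L> \<Longrightarrow> linear_set n L" "S = \<Union>\<L>"
    using assms by (auto simp: semilinear_set_def)
  have "linear_set (Suc n) ((\<lambda>v. v(n := Suc (v n))) ` L)" if L: "L \<in> \<L>" for L
  proof -
    obtain b P where bP: "b \<in> nvecs n" "finite P" "P \<subseteq> nvecs n" "L = lin_comb b P"
      using \<L>(2)[OF L] by (auto simp: linear_set_def)
    have "b(n := Suc (b n)) \<in> nvecs (Suc n)" using bP by (auto simp: nvecs_def)
    moreover have "(\<lambda>v. v(n := Suc (v n))) ` L = lin_comb (b(n := Suc (b n))) P"
      unfolding bP(4) lin_comb_def
      by (auto simp: image_def fun_eq_iff)
    moreover have "P \<subseteq> nvecs (Suc n)" using bP(3) nvecs_mono[of n "Suc n"] by auto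
    ultimately show ?thesis using bP(2) unfolding linear_set_def by metis
  qed
  then show ?thesis
    unfolding semilinear_set_def \<L>(3) image_Union using \<L>(1)
    by (intro exI[of _ "(`) (\<lambda>v. v(n := Suc (v n))) ` \<L>"]) auto
qed

text \<open>The \<open>a\<close>-th unit vector; as a period it lets coordinate \<open>a\<close>
  grow freely.\<close>

definition single :: "nat \<Rightarrow> nvec" where
  "single a = (\<lambda>j. of_bool (j = a))"

lemma inj_single: "inj single"
  by (rule injI) (metis single_def of_bool_eq_1_iff)

lemma lin_comb_empty: "v \<in> lin_comb b {} \<longleftrightarrow> v = b"
  by (simp add: lin_comb_def)

text \<open>Peels the periods of an explicit set off one at a time. When \<open>p\<close> already
  lies in \<open>P\<close>, the extra multiple is added to its coefficient.\<close>

lemma lin_comb_insert: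
  assumes "finite P"
  shows "v \<in> lin_comb b (insert p P) \<longleftrightarrow> (\<exists>c w. w \<in> lin_comb b P \<and> v = (\<lambda>j. w j + p j * c))"
proof (cases "p \<in> P")
  case True
  have sum: "(\<Sum>q\<in>P. q j * (z(p := z p + c)) q) = (\<Sum>q\<in>P. q j * z q) + p j * c" for j z c
    using assms True by (simp add: sum.remove[of P p] algebra_simps)
  have "\<exists>c w. w \<in> lin_comb b P \<and> v = (\<lambda>j. w j + p j * c)" if "v \<in> lin_comb b P"
    using that by (intro exI[of _ 0] exI[of _ v]) simp
  moreover have "(\<lambda>j. w j + p j * c) \<in> lin_comb b P" if w: "w \<in> lin_comb b P" for w c
  proof -
    obtain z where "w = (\<lambda>j. b j + (\<Sum>q\<in>P. q j * z q))" using w by (auto simp: lin_comb_def)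
    then have "(\<lambda>j. w j + p j * c) = (\<lambda>j. b j + (\<Sum>q\<in>P. q j * (z(p := z p + c)) q))"
      unfolding sum by (simp add: add.assoc)
    then show ?thesis unfolding lin_comb_def by blast
  qed
  ultimately show ?thesis using True by (auto simp: insert_absorb)
next
  case False
  have sum: "(\<Sum>q\<in>insert p P. q j * z q) = p j * z p + (\<Sum>q\<in>P. q j * z q)" for j z
    using assms False by simp
  have sum': "(\<Sum>q\<in>P. q j * (z(p := c)) q) = (\<Sum>q\<in>P. q j * z q)" for j z c
    using False by (intro sum.cong) auto
  show ?thesis
  proof
    assume "v \<in> lin_comb b (insert p P)"
    then obtain z where "v = (\<lambda>j. b j + (\<Sum>q\<in>insert p P. q j * z q))"
      by (auto simp: lin_comb_def)
    then have "v = (\<lambda>j. (b j + (\<Sum>q\<in>P. q j * z q)) + p j * z p)" by (simp add: sum fun_eq_iff)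
    then show "\<exists>c w. w \<in> lin_comb b P \<and> v = (\<lambda>j. w j + p j * c)"
      unfolding lin_comb_def by blast
  next
    assume "\<exists>c w. w \<in> lin_comb b P \<and> v = (\<lambda>j. w j + p j * c)"
    then obtain c z where "v = (\<lambda>j. (b j + (\<Sum>q\<in>P. q j * z q)) + p j * c)"
      by (auto simp: lin_comb_def)
    then have "v = (\<lambda>j. b j + (\<Sum>q\<in>insert p P. q j * (z(p := c)) q))"
      unfolding sum sum' by (simp add: algebra_simps)
    then show "v \<in> lin_comb b (insert p P)" unfolding lin_comb_def by blast
  qed
qed

lemma lin_comb_insertI:
  assumes "finite P" "w \<in> lin_comb b P" "v = (\<lambda>j. w j + p j * c)"
  shows "v \<in> lin_comb b (insert p P)"
  using assms by (auto simp: lin_comb_insert)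

lemma semilinear_lin_comb:
  assumes "b \<in> nvecs n" "finite P" "P \<subseteq> nvecs n"
  shows "semilinear_set n (lin_comb b P)"
proof -
  have "linear_set n (lin_comb b P)" unfolding linear_set_def using assms by blast
  then show ?thesis unfolding semilinear_set_def by (intro exI[of _ "{lin_comb b P}"]) simp
qed

lemma lin_comb_single:
  assumes "finite I"
  shows "v \<in> lin_comb b (single ` I) \<longleftrightarrow> (\<exists>u. (\<forall>j. j \<notin> I \<longrightarrow> u j = 0) \<and> v = (\<lambda>j. b j + u j))"
proof -
  have sum: "(\<Sum>p\<in>single ` I. p j * z p) = (if j \<in> I then z (single j) else 0)" for j z
  proof -
    have "(\<Sum>p\<in>single ` I. p j * z p) = (\<Sum>i\<in>I. single i j * z (single i))"
      by (rule sum.reindex_cong[OF inj_on_subset[OF inj_single]]) auto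
    also have "\<dots> = (\<Sum>i\<in>I. if j = i then z (single i) else 0)"
      by (intro sum.cong) (auto simp: single_def)
    also have "\<dots> = (if j \<in> I then z (single j) else 0)" using assms by (simp add: sum.delta)
    finally show ?thesis .
  qed
  show ?thesis
  proof
    assume "v \<in> lin_comb b (single ` I)"
    then obtain z where "v = (\<lambda>j. b j + (if j \<in> I then z (single j) else 0))"
      unfolding lin_comb_def sum by blast
    then show "\<exists>u. (\<forall>j. j \<notin> I \<longrightarrow> u j = 0) \<and> v = (\<lambda>j. b j + u j)"
      by (intro exI[of _ "\<lambda>j. if j \<in> I then z (single j) else 0"]) simp
  next
    assume "\<exists>u. (\<forall>j. j \<notin> I \<longrightarrow> u j = 0) \<and> v = (\<lambda>j. b j + u j)"
    then obtain u where u: "\<forall>j. j \<notin> I \<longrightarrow> u j = 0" "v = (\<lambda>j. b j + u j)" by blast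
    have "v = (\<lambda>j. b j + (\<Sum>p\<in>single ` I. p j * (u \<circ> inv single) p))"
      unfolding sum u(2) using u(1) by (auto simp: inv_f_f[OF inj_single])
    then show "v \<in> lin_comb b (single ` I)" unfolding lin_comb_def by blast
  qed
qed

lemma semilinear_supported:
  assumes "I \<subseteq> {..<n}"
  shows "semilinear_set n {v. \<forall>j. j \<notin> I \<longrightarrow> v j = 0}"
proof -
  have fin: "finite I" using assms finite_subset by blast
  have "{v. \<forall>j. j \<notin> I \<longrightarrow> v j = 0} = lin_comb (\<lambda>_. 0) (single ` I)"
    by (auto simp: lin_comb_single[OF fin])
  moreover have "semilinear_set n (lin_comb (\<lambda>_. 0) (single ` I))"
    by (rule semilinear_lin_comb) (use assms fin in \<open>auto simp: nvecs_def single_def\<close>)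
  ultimately show ?thesis by simp
qed

text \<open>The set is linear: the base \<open>single b\<close> gives the strict surplus,
  \<open>?p\<close> raises both coordinates together, and every coordinate other than
  \<open>a\<close> may also grow on its own.\<close>

lemma semilinear_less:
  assumes "a < n" "b < n" "a \<noteq> b"
  shows "semilinear_set n {v \<in> nvecs n. v a < v b}"
proof -
  let ?p = "\<lambda>j. single a j + single b j" and ?I = "{..<n} - {a}"
  have "v \<in> lin_comb (single b) (insert ?p (single ` ?I))" if v: "v \<in> nvecs n" "v a < v b" for v
  proof -
    \<comment> \<open>What is left of \<open>v\<close> after removing the base and
      \<open>v a\<close> copies of \<open>?p\<close>.\<close>
    define u where "u = v(a := 0, b := v b - v a - 1)"
    have "\<forall>j. j \<notin> ?I \<longrightarrow> u j = 0"
      using v assms by (auto simp: u_def nvecs_def)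
    then have "(\<lambda>j. single b j + u j) \<in> lin_comb (single b) (single ` ?I)"
      by (auto simp: lin_comb_single)
    moreover have "v = (\<lambda>j. (single b j + u j) + ?p j * v a)"
      using v assms by (auto simp: u_def single_def fun_eq_iff)
    ultimately show ?thesis by (subst lin_comb_insert) blast+
  qed
  moreover have "v \<in> nvecs n \<and> v a < v b" if "v \<in> lin_comb (single b) (insert ?p (single ` ?I))" for v
    using that assms
    by (simp add: lin_comb_insert lin_comb_single) (auto simp: single_def nvecs_def)
  ultimately have "{v \<in> nvecs n. v a < v b} = lin_comb (single b) (insert ?p (single ` ?I))"
    by blast
  moreover have "semilinear_set n (lin_comb (single b) (insert ?p (single ` ?I)))"
    by (rule semilinear_lin_comb) (use assms in \<open>auto simp: nvecs_def single_def\<close>)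
  ultimately show ?thesis by simp
qed

lemma semilinear_nvecs: "semilinear_set n (nvecs n)"
proof -
  have "nvecs n = {v. \<forall>j. j \<notin> {..<n} \<longrightarrow> v j = 0}" by (auto simp: nvecs_def)
  then show ?thesis using semilinear_supported[of "{..<n}" n] by simp
qed

section \<open>Languages with a distinguished first segment\<close>

text \<open>
  The automaton recognizing such a language flags its first transition in the extra coordinate \<open>n\<close>,
  so that its constraint set can tell the first segment from the later ones.
\<close>

definition two_phase :: "nat \<Rightarrow> nvec set \<Rightarrow> nvec set \<Rightarrow> nat word set" where
  "two_phase n P R = {\<alpha> \<in> omega_words {..<n}. \<exists>k. strict_mono k \<and> 0 < k 0 \<and>
     count_list (prefix (k 0) \<alpha>) \<in> P \<and> (\<forall>i. count_list (\<alpha> [k i \<rightarrow> k (Suc i)]) \<in> R)}"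

lemma weight_count_list:
  assumes "\<And>a. step s a = s" "\<And>a j. wt s a j = of_bool (j = a)"
  shows "reset_machine.weight step wt s xs = count_list xs"
  by (induction xs) (auto simp: assms reset_machine.weight.simps fun_eq_iff)

text \<open>Weights count letters, and coordinate \<open>n\<close>, which belongs to no letter, is
  raised only by the first transition. It is 1 on the first segment and 0 on all later ones, so the
  former can only match a flagged vector from \<open>P\<close> and the latter only a vector from
  \<open>R\<close>.\<close>

lemma two_phase_in_class:
  assumes n: "0 < n" and P: "semilinear_set n P" and R: "semilinear_set n R"
  shows "two_phase n P R \<in> det_weak_reset_class {..<n}"
proof -
  let ?flag = "\<lambda>v :: nvec. v(n := Suc (v n))"
  define wt :: "nat \<Rightarrow> nat \<Rightarrow> nvec"
    where "wt q a = (\<lambda>j. of_bool (j = a) + of_bool (q = 0 \<and> j = n))" for q a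
  define A :: "(nat, nat) pa" where
    "A = \<lparr>dim = Suc n, states = {0, 1}, alphabet = {..<n}, init = 0,
      trans = (\<lambda>(q, a). (q, a, wt q a, 1)) ` ({0, 1} \<times> {..<n}), acc = {1}, constr = ?flag ` P \<union> R\<rparr>"
  have PR: "P \<subseteq> nvecs n" "R \<subseteq> nvecs n" using P R by (auto dest: semilinear_set_subset)
  have pa: "parikh_automaton A"
    unfolding parikh_automaton_def
    using n semilinear_set_Un[OF semilinear_set_flag[OF P] semilinear_set_Suc[OF R]]
    by (auto simp: A_def wt_def nvecs_def)
  have det: "deterministic A"
    by (auto simp: deterministic_def A_def)
  define step :: "nat \<Rightarrow> nat \<Rightarrow> nat" where "step = (\<lambda>_ _. 1)"
  have step: "step q a = 1" for q a by (simp add: step_def)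
  define fin :: "nat set" where "fin = {1}"
  define G where "G = ?flag ` P \<union> R"
  interpret reset_machine step wt fin G .
  have run: "run q xs = (if xs = [] then q else 1)" for q xs
    by (induction xs arbitrary: q) (auto simp: step)
  have wts: "wt 1 a j = of_bool (j = a)" "wt 0 a j = of_bool (j = a) + of_bool (j = n)" for a j
    by (simp_all add: wt_def)
  have weight1: "weight 1 xs = count_list xs" for xs
    by (rule weight_count_list) (rule step wts(1))+
  have weight0: "weight 0 xs = (count_list xs)(n := Suc (count_list xs n))" if nonempty: "xs \<noteq> []" for xs
  proof -
    obtain a ys where xs: "xs = a # ys" using nonempty by (cases xs) auto
    show ?thesis unfolding xs weight.simps step[of 0 a] weight1 wts by auto
  qed
  note weight1 = weight1[unfolded One_nat_def]
  have A_sel: "states A = {0, 1}" "alphabet A = {..<n}" "init A = 0" "acc A = fin" "constr A = G"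
    by (simp_all add: A_def fin_def G_def)
  have "(q, a, v, q') \<in> trans A \<longleftrightarrow> v = wt q a \<and> q' = step q a"
    if "q \<in> states A" "a \<in> alphabet A" for q a v q'
    using that by (auto simp: A_def step[of q a])
  then have "weak_reset_language A = {\<alpha> \<in> omega_words {..<n}. accepts 0 \<alpha>}"
    using language_accepts[OF pa] unfolding A_sel by blast
  also have "\<dots> = two_phase n P R"
  proof -
    have "accepts 0 \<alpha> \<longleftrightarrow> (\<exists>k. strict_mono k \<and> 0 < k 0 \<and> count_list (prefix (k 0) \<alpha>) \<in> P \<and>
        (\<forall>i. count_list (\<alpha> [k i \<rightarrow> k (Suc i)]) \<in> R))" (is "_ \<longleftrightarrow> (\<exists>k. ?T k)")
      if \<alpha>: "\<alpha> \<in> omega_words {..<n}" for \<alpha>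
    proof -
      have cn: "count_list (\<alpha> [i \<rightarrow> j]) n = 0" for i j
        using \<alpha> by (auto simp: count_list_0_iff omega_words_def)
      have first: "weight 0 (prefix m \<alpha>) \<in> G \<longleftrightarrow> count_list (prefix m \<alpha>) \<in> P"
        if "0 < m" for m
      proof -
        have inj: "v = count_list (prefix m \<alpha>)"
          if "?flag (count_list (prefix m \<alpha>)) = ?flag v" "v \<in> P" for v
          using that cn[of 0 m] by (metis fun_upd_same fun_upd_triv fun_upd_upd nat.inject)
        have "?flag (count_list (prefix m \<alpha>)) \<notin> R"
        proof
          assume "?flag (count_list (prefix m \<alpha>)) \<in> R"
          then have "?flag (count_list (prefix m \<alpha>)) n = 0"
            using PR(2) by (auto simp: nvecs_def simp del: fun_upd_apply)
          then show False by simp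
        qed
        then show ?thesis using that inj by (auto simp: weight0 G_def)
      qed
      have later: "count_list (\<alpha> [i \<rightarrow> j]) \<in> G \<longleftrightarrow> count_list (\<alpha> [i \<rightarrow> j]) \<in> R" for i j
        using cn[of i j] by (auto simp: G_def dest!: arg_cong[of _ _ "\<lambda>v. v n"])
      show ?thesis
      proof
        assume "accepts 0 \<alpha>"
        then obtain k where k: "chain 0 \<alpha> k" by (auto simp: accepts_def)
        then have k0: "k 0 = 0" and mono: "strict_mono k"
          and gd: "\<And>i. weight (run 0 (prefix (k i) \<alpha>)) (\<alpha> [k i \<rightarrow> k (Suc i)]) \<in> G"
          by (simp_all add: chain_def)
        have pos: "0 < k (Suc i)" for i using strict_monoD[OF mono, of 0 "Suc i"] by simp
        have "count_list (\<alpha> [k (Suc i) \<rightarrow> k (Suc (Suc i))]) \<in> R" for i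
          using gd[of "Suc i"] pos[of i] later by (simp add: run weight1)
        then have "?T (k \<circ> Suc)"
          using gd[of 0] first[OF pos[of 0]] pos mono by (auto simp: k0 run strict_mono_def)
        then show "\<exists>k. ?T k" by blast
      next
        assume "\<exists>k. ?T k"
        then obtain k where k: "?T k" by blast
        then have pos: "0 < k i" for i
          by (metis gr_zeroI not_less_zero strict_mono_less)
        then have ne: "k i \<noteq> 0" for i by (metis less_irrefl)
        have "chain 0 \<alpha> (case_nat 0 k)"
          unfolding chain_def
        proof (intro conjI allI)
          show "strict_mono (case_nat 0 k)"
            using k pos by (auto simp: strict_mono_Suc_iff split: nat.split)
          fix i
          show "run 0 (prefix (case_nat 0 k (Suc i)) \<alpha>) \<in> fin" using pos by (simp add: run fin_def)
          show "weight (run 0 (prefix (case_nat 0 k i) \<alpha>))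
            (\<alpha> [case_nat 0 k i \<rightarrow> case_nat 0 k (Suc i)]) \<in> G"
            using k first[OF pos[of 0]] later
            by (cases i) (simp_all add: run weight1 ne)
        qed simp
        then show "accepts 0 \<alpha>" by (auto simp: accepts_def)
      qed
    qed
    then show ?thesis by (auto simp: two_phase_def)
  qed
  finally show ?thesis
    unfolding det_weak_reset_class_def using pa det A_sel(2) by blast
qed

lemma count_list_nvecs: "\<alpha> \<in> omega_words {..<n} \<Longrightarrow> count_list (\<alpha> [i \<rightarrow> j]) \<in> nvecs n"
  by (auto simp: nvecs_def count_list_0_iff omega_words_def) (meson leD)

text \<open>With an unrestricted second phase one may reset after every further letter, so only the
  first segment is tested.\<close>

lemma two_phase_nvecs:
  "two_phase n P (nvecs n) = {\<alpha> \<in> omega_words {..<n}. \<exists>k>0. count_list (prefix k \<alpha>) \<in> P}"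
proof -
  have "\<exists>k :: nat \<Rightarrow> nat. strict_mono k \<and> 0 < k 0 \<and> count_list (prefix (k 0) \<alpha>) \<in> P"
    if "0 < m" "count_list (prefix m \<alpha>) \<in> P" for m :: nat and \<alpha>
    using that by (intro exI[of _ "\<lambda>i. m + i"]) (auto simp: strict_mono_def)
  then show ?thesis unfolding two_phase_def using count_list_nvecs by blast
qed

section \<open>Complement\<close>

text \<open>
  With letters \<open>a, b, c\<close> coded as \<open>0, 1, 2\<close>, the complement of this language consists of the words
  all of whose prefixes satisfy \<open>#c \<le> #b \<le> #c + #a\<close>.
\<close>

definition unsafe :: "nat word set" where
  "unsafe = two_phase 3 ({v \<in> nvecs 3. v 1 < v 2} \<union> {v \<in> nvecs 3. v 2 + v 0 < v 1}) (nvecs 3)"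

lemma unsafe_in_class: "unsafe \<in> det_weak_reset_class {..<3}"
proof -
  let ?P = "{\<lambda>j. single 0 j + single 1 j, \<lambda>j. single 2 j + single 1 j, single 1}"
  have "{v \<in> nvecs 3. v 2 + v 0 < v 1} = lin_comb (single 1) ?P"
  proof (intro set_eqI iffI)
    fix v assume v: "v \<in> {v \<in> nvecs 3. v 2 + v 0 < v 1}"
    \<comment> \<open>Each letter \<open>0\<close> and each letter \<open>2\<close> is paired with a
      letter \<open>1\<close>; the base and the multiple of \<open>single 1\<close> form the strict
      surplus.\<close>
    have "v = (\<lambda>j. single 1 j + single 1 j * (v 1 - v 0 - v 2 - 1) +
        (single 2 j + single 1 j) * v 2 + (single 0 j + single 1 j) * v 0)"
    proof
      fix j :: nat
      consider "j = 0" | "j = 1" | "j = 2" | "3 \<le> j" by linarith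
      then show "v j = single 1 j + single 1 j * (v 1 - v 0 - v 2 - 1) +
        (single 2 j + single 1 j) * v 2 + (single 0 j + single 1 j) * v 0"
        using v by cases (auto simp: single_def nvecs_def)
    qed
    then show "v \<in> lin_comb (single 1) ?P"
      by (simp add: lin_comb_insert lin_comb_empty) blast
  qed (auto simp: lin_comb_insert lin_comb_empty nvecs_def single_def)
  moreover have "semilinear_set 3 (lin_comb (single 1) ?P)"
    by (rule semilinear_lin_comb) (auto simp: nvecs_def single_def)
  ultimately have "semilinear_set 3 {v \<in> nvecs 3. v 2 + v 0 < v 1}" by simp
  then show ?thesis
    unfolding unsafe_def
    by (intro two_phase_in_class semilinear_set_Un semilinear_less semilinear_nvecs) auto
qed

text \<open>After the splice, only \<open>Suc n\<close> letters \<open>0\<close> have to pay for a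
  full block of \<open>Suc n'\<close> letters \<open>1\<close>, which begins when there are already
  at least as many \<open>1\<close> as \<open>2\<close>.\<close>

lemma safe_not_in_class: "omega_words {..<3} - unsafe \<notin> det_weak_reset_class {..<3}"
proof
  assume in_class: "omega_words {..<3} - unsafe \<in> det_weak_reset_class {..<3}"
  have safe: "\<alpha> \<in> omega_words {..<3} - unsafe \<longleftrightarrow> \<alpha> \<in> omega_words {..<3} \<and>
      (\<forall>k. count_list (prefix k \<alpha>) 2 \<le> count_list (prefix k \<alpha>) 1 \<and>
        count_list (prefix k \<alpha>) 1 \<le> count_list (prefix k \<alpha>) 2 + count_list (prefix k \<alpha>) 0)"
    for \<alpha>
  proof -
    have "\<alpha> \<in> unsafe \<longleftrightarrow> (\<exists>k. count_list (prefix k \<alpha>) 1 < count_list (prefix k \<alpha>) 2 \<or>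
        count_list (prefix k \<alpha>) 2 + count_list (prefix k \<alpha>) 0 < count_list (prefix k \<alpha>) 1)"
      if "\<alpha> \<in> omega_words {..<3}"
    proof -
      have "0 < k" if "count_list (prefix k \<alpha>) 1 < count_list (prefix k \<alpha>) 2 \<or>
        count_list (prefix k \<alpha>) 2 + count_list (prefix k \<alpha>) 0 < count_list (prefix k \<alpha>) 1" for k
        using that by (cases k) auto
      then show ?thesis
        using that count_list_nvecs[OF that] by (auto simp: unsafe_def two_phase_nvecs)
    qed
    then show ?thesis by (auto simp: not_less) (meson leD)+
  qed
  define ys where "ys n = replicate (Suc n) 1 @ replicate (Suc n) (2::nat)" for n
  define x where "x n = replicate (Suc n) 0 \<frown> (ys n)\<^sup>\<omega>" for n
  have ys: "ys n \<noteq> []" "set (ys n) = {1, 2}" "length (ys n) = 2 * Suc n" for n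
    by (auto simp: ys_def)
  have set_iter: "set (prefix k ((ys n)\<^sup>\<omega>)) \<subseteq> {1, 2}" for n k
  proof -
    have "set (prefix k ((ys n)\<^sup>\<omega>)) \<subseteq> set (ys n)"
      unfolding prefix_iter[OF ys(1)] by (auto dest: in_set_takeD)
    then show ?thesis by (simp add: ys)
  qed
  have x_safe: "x n \<in> omega_words {..<3} - unsafe" for n
    unfolding safe
  proof (intro conjI allI)
    show "x n \<in> omega_words {..<3}"
      unfolding x_def omega_words_conc
      using omega_words_iter[OF ys(1), of n "{..<3}"] ys(2)[of n] by auto
    fix k
    show "count_list (prefix k (x n)) 2 \<le> count_list (prefix k (x n)) 1"
      "count_list (prefix k (x n)) 1 \<le> count_list (prefix k (x n)) 2 + count_list (prefix k (x n)) 0"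
    proof (atomize (full), cases "k \<le> Suc n")
      case True
      then show "count_list (prefix k (x n)) 2 \<le> count_list (prefix k (x n)) 1 \<and>
        count_list (prefix k (x n)) 1 \<le> count_list (prefix k (x n)) 2 + count_list (prefix k (x n)) 0"
        by (simp add: x_def count_list_replicate del: replicate_Suc)
    next
      case False
      then have "prefix k (x n) = replicate (Suc n) 0 @
          concat (replicate ((k - Suc n) div length (ys n)) (ys n)) @
          take ((k - Suc n) mod length (ys n)) (ys n)"
        by (simp add: x_def prefix_iter[OF ys(1)] del: replicate_Suc)
      then show "count_list (prefix k (x n)) 2 \<le> count_list (prefix k (x n)) 1 \<and>
        count_list (prefix k (x n)) 1 \<le> count_list (prefix k (x n)) 2 + count_list (prefix k (x n)) 0"
        by (simp add: count_list_replicate count_list_concat_replicate ys_def del: replicate_Suc)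
           linarith
    qed
  qed
  obtain n n' i j where n: "n < n'" "Suc n \<le> i" "Suc n' \<le> j"
    and spl: "prefix i (x n) \<frown> suffix j (x n') \<in> omega_words {..<3} - unsafe"
    by (rule fooling[OF in_class x_safe, of Suc])
  \<comment> \<open>The spliced word up to a point where a complete copy of \<open>ys n'\<close>
    starts.\<close>
  define z where "z = replicate (Suc n) 0 @ prefix (i - Suc n) ((ys n)\<^sup>\<omega>) @
    drop ((j - Suc n') mod length (ys n')) (ys n')"
  have z0: "count_list z 0 = Suc n"
  proof -
    have "0 \<notin> set (prefix (i - Suc n) ((ys n)\<^sup>\<omega>))" by (rule notI, drule subsetD[OF set_iter]) simp
    moreover have "0 \<notin> set (drop ((j - Suc n') mod length (ys n')) (ys n'))"
      by (rule notI, drule in_set_dropD) (simp add: ys(2))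
    ultimately show ?thesis
      by (simp add: z_def count_list_replicate count_list_0_iff del: replicate_Suc)
  qed
  let ?w = "z @ replicate (Suc n') 1"
  have "prefix i (x n) \<frown> suffix j (x n') = z \<frown> (ys n')\<^sup>\<omega>"
    using n by (simp add: x_def z_def suffix_iter[OF ys(1)] del: replicate_Suc)
  also have "(ys n')\<^sup>\<omega> = ys n' \<frown> (ys n')\<^sup>\<omega>"
    by (rule iter_unroll) (use ys(1) in simp)
  also have "z \<frown> ys n' \<frown> (ys n')\<^sup>\<omega> = ?w \<frown> replicate (Suc n') 2 \<frown> (ys n')\<^sup>\<omega>"
    unfolding ys_def[of n'] conc_conc by (simp only: append_assoc)
  finally have eq: "prefix i (x n) \<frown> suffix j (x n') = ?w \<frown> replicate (Suc n') 2 \<frown> (ys n')\<^sup>\<omega>" .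
  have pw: "prefix (length ?w) (prefix i (x n) \<frown> suffix j (x n')) = ?w"
    unfolding eq by (rule prefix_conc_length)
  have "prefix i (x n) \<frown> suffix j (x n') = z \<frown> replicate (Suc n') 1 \<frown> replicate (Suc n') 2 \<frown> (ys n')\<^sup>\<omega>"
    unfolding eq conc_conc by (simp only: append_assoc)
  then have pz: "prefix (length z) (prefix i (x n) \<frown> suffix j (x n')) = z"
    by (simp only: prefix_conc_length)
  note k = spl[unfolded safe, THEN conjunct2, rule_format]
  have "count_list z 2 \<le> count_list z 1" using k[of "length z"] unfolding pz by blast
  moreover have "count_list ?w 1 \<le> count_list ?w 2 + count_list ?w 0"
    using k[of "length ?w"] unfolding pw by blast
  ultimately show False using n(1) z0
    by (simp add: count_list_replicate del: replicate_Suc)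
qed

section \<open>Intersection\<close>

text \<open>
  The letters \<open>0, 1, 2, 3\<close> are the steps east, west, north and south of a walk on the grid; the letters
  \<open>4\<close> and \<open>5\<close> are separators. A word is in \<open>rendezvous h\<close> iff some grid point is visited in every
  block between consecutive separators \<open>h\<close>; the resets are the visits to that point.
\<close>

definition pos :: "nat list \<Rightarrow> int \<times> int" where
  "pos u = (int (count_list u 0) - int (count_list u 1), int (count_list u 2) - int (count_list u 3))"

lemma pos_append: "pos (u @ v) = pos u + pos v"
  by (simp add: pos_def)

definition rendezvous :: "nat \<Rightarrow> nat word set" where
  "rendezvous h = {\<alpha> \<in> omega_words {..<6}. \<exists>v. \<forall>m. \<exists>k>0.
     count_list (prefix k \<alpha>) h = m \<and> pos (prefix k \<alpha>) = v}"

lemma rendezvousI: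
  assumes "\<alpha> \<in> omega_words {..<6}"
    and "\<And>m. \<exists>u \<beta>. \<alpha> = u \<frown> \<beta> \<and> u \<noteq> [] \<and> count_list u h = m \<and> pos u = v"
  shows "\<alpha> \<in> rendezvous h"
proof -
  have "\<exists>k>0. count_list (prefix k \<alpha>) h = m \<and> pos (prefix k \<alpha>) = v" for m
  proof -
    obtain u \<beta> where u: "\<alpha> = u \<frown> \<beta>" "u \<noteq> []" "count_list u h = m" "pos u = v"
      using assms(2)[of m] by blast
    then have "prefix (length u) \<alpha> = u" by simp
    then show ?thesis using u by (intro exI[of _ "length u"]) simp
  qed
  then show ?thesis unfolding rendezvous_def using assms(1) by blast
qed

lemma rendezvousE:
  assumes "\<alpha> \<in> rendezvous h"
  obtains v where "\<And>m. \<exists>u \<beta>. \<alpha> = u \<frown> \<beta> \<and> count_list u h = m \<and> pos u = v"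
proof -
  obtain v where v: "\<And>m. \<exists>k>0. count_list (prefix k \<alpha>) h = m \<and> pos (prefix k \<alpha>) = v"
    using assms unfolding rendezvous_def by blast
  have "\<exists>u \<beta>. \<alpha> = u \<frown> \<beta> \<and> count_list u h = m \<and> pos u = v" for m
    using v[of m] by (metis prefix_suffix)
  then show thesis using that by blast
qed

text \<open>Between two adjacent separators lies the empty block, which visits a single grid point;
  the rendezvous point has to be that one.\<close>

lemma rendezvous_pinned:
  assumes "\<And>m. \<exists>u \<beta>. \<alpha> = u \<frown> \<beta> \<and> count_list u h = m \<and> pos u = v"
    and "\<alpha> = p \<frown> [h, h] \<frown> \<beta>"
  shows "pos (p @ [h]) = v"
proof -
  obtain u \<gamma> where u: "\<alpha> = u \<frown> \<gamma>" "count_list u h = count_list (p @ [h]) h" "pos u = v"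
    using assms(1)[of "count_list (p @ [h]) h"] by blast
  have "u \<frown> \<gamma> = (p @ [h]) \<frown> ([] @ [h]) \<frown> \<beta>" using u(1) assms(2) by simp
  then obtain w z where "u = (p @ [h]) @ w" "[] = w @ z"
    using conc_block[of u \<gamma> "p @ [h]" "[]" h \<beta>] u(2) by auto
  then show ?thesis using u(3) by simp
qed

text \<open>No \<open>h\<close> may occur before the first reset, and between resets there are
  exactly one \<open>h\<close> and a closed walk. So the resets run through the blocks one by one
  and all take place at the same point.\<close>

lemma rendezvous_in_class:
  assumes h: "h = 4 \<or> h = 5"
  shows "rendezvous h \<in> det_weak_reset_class {..<6}"
proof -
  let ?P = "{v. \<forall>j. j \<notin> {..<6} - {h} \<longrightarrow> v j = 0}"
  let ?p = "\<lambda>j. single 0 j + single 1 j" and ?q = "\<lambda>j. single 2 j + single 3 j"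
  let ?R = "{v \<in> nvecs 6. v 0 = v 1 \<and> v 2 = v 3 \<and> v h = 1}"
  \<comment> \<open>\<open>9 - h\<close> is the other separator, which may occur freely; the
    remaining periods pair opposite steps.\<close>
  let ?l = "lin_comb (single h) (insert ?p (insert ?q (single ` {9 - h})))"
  have "?R = ?l"
  proof (intro set_eqI iffI)
    fix v assume v: "v \<in> ?R"
    define u where "u j = (if j = 9 - h then v j else 0)" for j
    have "v = (\<lambda>j. single h j + u j + ?q j * v 2 + ?p j * v 0)"
    proof
      fix j :: nat
      consider "j = 0" | "j = 1" | "j = 2" | "j = 3" | "j = 4" | "j = 5" | "6 \<le> j" by linarith
      then show "v j = single h j + u j + ?q j * v 2 + ?p j * v 0"
        using v h by cases (auto simp: single_def nvecs_def u_def)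
    qed
    moreover have "(\<lambda>j. single h j + u j) \<in> lin_comb (single h) (single ` {9 - h})"
      by (rule lin_comb_single[THEN iffD2], simp, rule exI[of _ u]) (simp add: u_def)
    then have "(\<lambda>j. single h j + u j + ?q j * v 2) \<in> lin_comb (single h) (insert ?q (single ` {9 - h}))"
      by (rule lin_comb_insertI[rotated]) simp_all
    ultimately show "v \<in> ?l" by (blast intro: lin_comb_insertI[OF finite.insertI[OF finite_imageI[OF finite.insertI[OF finite.emptyI]]]])
  next
    fix v assume "v \<in> ?l"
    then obtain c w' where w': "w' \<in> lin_comb (single h) (insert ?q (single ` {9 - h}))"
      "v = (\<lambda>j. w' j + ?p j * c)"
      by (subst (asm) lin_comb_insert) blast+
    from w'(1) obtain d w where "w \<in> lin_comb (single h) (single ` {9 - h})"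
      "w' = (\<lambda>j. w j + ?q j * d)"
      by (subst (asm) lin_comb_insert) blast+
    then show "v \<in> ?R"
      using h w'(2) by (subst (asm) lin_comb_single) (auto simp: nvecs_def single_def)
  qed
  moreover have "semilinear_set 6 ?l"
    by (rule semilinear_lin_comb) (use h in \<open>auto simp: nvecs_def single_def\<close>)
  ultimately have R: "semilinear_set 6 ?R" by simp
  have P: "semilinear_set 6 ?P" by (rule semilinear_supported) auto
  have cP: "count_list (\<alpha> [i \<rightarrow> j]) \<in> ?P \<longleftrightarrow> count_list (\<alpha> [i \<rightarrow> j]) h = 0"
    if "\<alpha> \<in> omega_words {..<6}" for \<alpha> i j
    using count_list_nvecs[OF that, of i j] h by (auto simp: nvecs_def)
  have seg: "count_list (prefix l \<alpha>) a = count_list (prefix k \<alpha>) a + count_list (\<alpha> [k \<rightarrow> l]) a"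
    if "k \<le> l" for k l a and \<alpha> :: "nat word"
    using subsequence_append[of \<alpha> k "l - k"] that by simp
  have "\<alpha> \<in> two_phase 6 ?P ?R \<longleftrightarrow> \<alpha> \<in> rendezvous h" for \<alpha>
  proof
    assume "\<alpha> \<in> two_phase 6 ?P ?R"
    then obtain k where \<alpha>: "\<alpha> \<in> omega_words {..<6}" and k: "strict_mono k" "0 < k 0"
      "count_list (prefix (k 0) \<alpha>) h = 0" "\<And>i. count_list (\<alpha> [k i \<rightarrow> k (Suc i)]) \<in> ?R"
      unfolding two_phase_def using cP by blast
    have "count_list (prefix (k m) \<alpha>) h = m \<and> pos (prefix (k m) \<alpha>) = pos (prefix (k 0) \<alpha>)" for m
    proof (induction m)
      case (Suc m)
      have "k m \<le> k (Suc m)" using k(1) by (simp add: strict_mono_less_eq)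
      then show ?case using Suc k(4)[of m] by (simp add: seg[of "k m" "k (Suc m)"] pos_def)
    qed (simp add: k)
    moreover have "0 < k m" for m
      using k(1,2) by (metis gr_zeroI not_less_zero strict_mono_less)
    ultimately show "\<alpha> \<in> rendezvous h" using \<alpha> unfolding rendezvous_def by blast
  next
    assume "\<alpha> \<in> rendezvous h"
    then obtain v k where \<alpha>: "\<alpha> \<in> omega_words {..<6}" and k: "\<And>m. 0 < k m"
      "\<And>m. count_list (prefix (k m) \<alpha>) h = m" "\<And>m. pos (prefix (k m) \<alpha>) = v"
      unfolding rendezvous_def mem_Collect_eq by metis
    \<comment> \<open>The visits \<open>k m\<close> were chosen independently, but a prefix with
      more separators is longer.\<close>
    have lt: "k i < k (Suc i)" for i
    proof (rule ccontr)
      assume "\<not> k i < k (Suc i)"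
      then have "Suc i \<le> i" using seg[of "k (Suc i)" "k i" \<alpha> h] k(2) by simp
      then show False by simp
    qed
    have "count_list (\<alpha> [k i \<rightarrow> k (Suc i)]) \<in> ?R" for i
      using count_list_nvecs[OF \<alpha>] k(2)[of i] k(2)[of "Suc i"] k(3)[of i] k(3)[of "Suc i"] lt[of i]
      by (auto simp: seg[of "k i" "k (Suc i)"] pos_def)
    moreover have "strict_mono k" using lt by (simp add: strict_mono_Suc_iff)
    ultimately show "\<alpha> \<in> two_phase 6 ?P ?R"
      unfolding two_phase_def using \<alpha> k cP[OF \<alpha>] by auto
  qed
  then have "two_phase 6 ?P ?R = rendezvous h" by (rule set_eqI)
  then show ?thesis using two_phase_in_class[OF _ P R] by (simp only: zero_less_numeral)
qed

text \<open>In the spliced word the pairs of \<open>4\<close> pin two points that must coincide, so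
  the part \<open>z\<close> between \<open>xs n\<close> and a copy of \<open>xs n'\<close> has
  displacement 0. The pairs of \<open>5\<close> then pin the points \<open>Suc n\<close> and
  \<open>Suc n'\<close> steps east of the origin, which differ.\<close>

lemma rendezvous_Int_not_in_class:
  "rendezvous 4 \<inter> rendezvous 5 \<notin> det_weak_reset_class {..<6}"
proof
  assume in_class: "rendezvous 4 \<inter> rendezvous 5 \<in> det_weak_reset_class {..<6}"
  define xs :: "nat \<Rightarrow> nat list"
    where "xs n = replicate (Suc n) 0 @ [5, 5] @ replicate (Suc n) 1 @ [4, 4]" for n
  have xs: "xs n \<noteq> []" "set (xs n) \<subseteq> {..<6}" for n by (auto simp: xs_def)
  have pos_rep: "pos (concat (replicate m (xs n))) = 0" for m n
    by (simp add: pos_def count_list_concat_replicate xs_def count_list_replicate zero_prod_def)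
  have mem: "(xs n)\<^sup>\<omega> \<in> rendezvous 4 \<inter> rendezvous 5" for n
  proof
    \<comment> \<open>Each period contains a pair of each separator. After \<open>m div 2\<close>
      periods, block \<open>m\<close> is reached just before the pair if \<open>m\<close> is even
      and between its two letters if \<open>m\<close> is odd.\<close>
    let ?c = "\<lambda>m. concat (replicate (m div 2) (xs n))"
    show "(xs n)\<^sup>\<omega> \<in> rendezvous 4"
    proof (rule rendezvousI[OF omega_words_iter[OF xs], of _ _ 0])
      fix m :: nat
      let ?u = "replicate (Suc n) 0 @ [5, 5] @ replicate (Suc n) (1::nat)"
      let ?v = "?u @ (if even m then [] else [4])"
      let ?w = "if even m then [4, 4] else [4]"
      have "?v @ ?w = xs n" by (simp add: xs_def)
      then have "(xs n)\<^sup>\<omega> = (?c m @ ?v) \<frown> ?w \<frown> (xs n)\<^sup>\<omega>" by (rule iter_split) simp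
      moreover have "count_list (?c m @ ?v) 4 = m"
        by (simp add: count_list_concat_replicate xs_def count_list_replicate) presburger
      moreover have "pos (?c m @ ?v) = 0"
        unfolding pos_append pos_rep by (simp add: pos_def count_list_replicate zero_prod_def)
      ultimately show "\<exists>u \<beta>. (xs n)\<^sup>\<omega> = u \<frown> \<beta> \<and> u \<noteq> [] \<and> count_list u 4 = m \<and> pos u = 0"
        by (intro exI[of _ "?c m @ ?v"] exI[of _ "?w \<frown> (xs n)\<^sup>\<omega>"]) simp
    qed
    show "(xs n)\<^sup>\<omega> \<in> rendezvous 5"
    proof (rule rendezvousI[OF omega_words_iter[OF xs], of _ _ "(int (Suc n), 0)"])
      fix m :: nat
      let ?v = "replicate (Suc n) (0::nat) @ (if even m then [] else [5])"
      let ?w = "(if even m then [5, 5] else [5]) @ replicate (Suc n) 1 @ [4, 4]"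
      have "?v @ ?w = xs n" by (simp add: xs_def)
      then have "(xs n)\<^sup>\<omega> = (?c m @ ?v) \<frown> ?w \<frown> (xs n)\<^sup>\<omega>" by (rule iter_split) simp
      moreover have "count_list (?c m @ ?v) 5 = m"
        by (simp add: count_list_concat_replicate xs_def count_list_replicate) presburger
      moreover have "pos (?c m @ ?v) = (int (Suc n), 0)"
        unfolding pos_append pos_rep by (simp add: pos_def count_list_replicate)
      ultimately show "\<exists>u \<beta>. (xs n)\<^sup>\<omega> = u \<frown> \<beta> \<and> u \<noteq> [] \<and> count_list u 5 = m \<and>
          pos u = (int (Suc n), 0)"
        by (intro exI[of _ "?c m @ ?v"] exI[of _ "?w \<frown> (xs n)\<^sup>\<omega>"]) simp
    qed
  qed
  obtain n n' i j where n: "n < n'" "length (xs n) \<le> i"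
    and spl: "prefix i ((xs n)\<^sup>\<omega>) \<frown> suffix j ((xs n')\<^sup>\<omega>) \<in> rendezvous 4 \<inter> rendezvous 5"
    by (rule fooling[OF in_class mem, of "\<lambda>n. length (xs n)"])
  let ?\<alpha> = "prefix i ((xs n)\<^sup>\<omega>) \<frown> suffix j ((xs n')\<^sup>\<omega>)"
  define z where "z = prefix (i - length (xs n)) ((xs n)\<^sup>\<omega>) @ drop (j mod length (xs n')) (xs n')"
  have "prefix i ((xs n)\<^sup>\<omega>) = xs n @ prefix (i - length (xs n)) ((xs n)\<^sup>\<omega>)"
    using iter_unroll[of "xs n"] xs(1)[of n] n(2) by (metis length_greater_0_conv prefix_conc_snd)
  moreover have "suffix j ((xs n')\<^sup>\<omega>) = drop (j mod length (xs n')) (xs n') \<frown> xs n' \<frown> (xs n')\<^sup>\<omega>"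
    using suffix_iter[OF xs(1), of j n'] iter_unroll[of "xs n'"] xs(1)[of n'] by simp
  ultimately have eq: "?\<alpha> = xs n \<frown> z \<frown> xs n' \<frown> (xs n')\<^sup>\<omega>" by (simp add: z_def)
  obtain v where v: "\<And>m. \<exists>u \<beta>. ?\<alpha> = u \<frown> \<beta> \<and> count_list u 4 = m \<and> pos u = v"
    using spl rendezvousE[of ?\<alpha> 4] by blast
  obtain v' where v': "\<And>m. \<exists>u \<beta>. ?\<alpha> = u \<frown> \<beta> \<and> count_list u 5 = m \<and> pos u = v'"
    using spl rendezvousE[of ?\<alpha> 5] by blast
  let ?s = "\<lambda>n. replicate (Suc n) (0::nat)"
  let ?t = "\<lambda>n. replicate (Suc n) (0::nat) @ [5, 5] @ replicate (Suc n) 1"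
  have "?\<alpha> = ?t n \<frown> [4, 4] \<frown> z \<frown> xs n' \<frown> (xs n')\<^sup>\<omega>"
    "?\<alpha> = (xs n @ z @ ?t n') \<frown> [4, 4] \<frown> (xs n')\<^sup>\<omega>"
    unfolding eq by (simp_all add: xs_def)
  from this[THEN rendezvous_pinned[OF v]]
  have "pos (?t n @ [4]) = pos (xs n @ z @ ?t n' @ [4])" by simp
  then have z: "pos z = 0"
    by (simp add: pos_def xs_def count_list_replicate zero_prod_def)
  have "?\<alpha> = ?s n \<frown> [5, 5] \<frown> (replicate (Suc n) 1 @ [4, 4]) \<frown> z \<frown> xs n' \<frown> (xs n')\<^sup>\<omega>"
    "?\<alpha> = (xs n @ z @ ?s n') \<frown> [5, 5] \<frown> (replicate (Suc n') 1 @ [4, 4]) \<frown> (xs n')\<^sup>\<omega>"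
    unfolding eq by (simp_all add: xs_def)
  from this[THEN rendezvous_pinned[OF v']]
  have "pos (?s n @ [5]) = pos (xs n @ z @ ?s n' @ [5])" by simp
  then show False using z n(1)
    by (simp add: pos_def xs_def count_list_replicate zero_prod_def)
qed

section \<open>Union\<close>

lemma zero_tail_eventually:
  assumes "strict_mono k" and "\<And>i a. a \<noteq> 0 \<Longrightarrow> count_list (\<alpha> [k i \<rightarrow> k (Suc i)]) a = 0"
    and "k 0 \<le> j"
  shows "\<alpha> j = (0::nat)"
proof -
  have "\<forall>j. k 0 \<le> j \<and> j < k n \<longrightarrow> \<alpha> j = 0" for n
  proof (induction n)
    case (Suc n)
    have "\<alpha> j = 0" if "k n \<le> j" "j < k (Suc n)" for j
    proof (rule ccontr)
      assume "\<alpha> j \<noteq> 0"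
      then have "\<alpha> j \<notin> set (\<alpha> [k n \<rightarrow> k (Suc n)])"
        using assms(2) by (metis count_list_0_iff)
      then show False using that by auto
    qed
    then show ?case using Suc by (meson not_less)
  qed simp
  moreover have "j < k (Suc j)"
    using strict_mono_imp_increasing[OF assms(1), of "Suc j"] by simp
  ultimately show ?thesis using assms(3) by blast
qed

text \<open>Geometrically, the walk finally heads east forever in a row south of the origin.\<close>

definition drain :: "nat word set" where
  "drain = two_phase 6 {v \<in> nvecs 6. v 2 < v 3} {v. \<forall>j. j \<notin> {0} \<longrightarrow> v j = 0}"

lemma drain_in_class: "drain \<in> det_weak_reset_class {..<6}"
  unfolding drain_def
  by (intro two_phase_in_class semilinear_less semilinear_supported) auto

lemma drainE:
  assumes "\<alpha> \<in> drain"
  obtains k where "\<And>j. k \<le> j \<Longrightarrow> \<alpha> j = 0"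
    "count_list (prefix k \<alpha>) 2 < count_list (prefix k \<alpha>) 3"
proof -
  obtain k where k: "strict_mono k" "count_list (prefix (k 0) \<alpha>) 2 < count_list (prefix (k 0) \<alpha>) 3"
    "\<And>i. count_list (\<alpha> [k i \<rightarrow> k (Suc i)]) \<in> {v. \<forall>j. j \<notin> {0} \<longrightarrow> v j = 0}"
    using assms unfolding drain_def two_phase_def by blast
  have "\<alpha> j = 0" if "k 0 \<le> j" for j
    by (rule zero_tail_eventually[OF k(1) _ that]) (use k(3) in simp)
  then show thesis using that k(2) by blast
qed

text \<open>The first reset may lie inside \<open>u\<close> or beyond it, but only \<open>0\<close>
  is read from there on, so the counts of \<open>2\<close> and \<open>3\<close> up to the reset are
  those of \<open>u\<close>.\<close>

lemma conc_zeros_drain_iff: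
  "u \<frown> (\<lambda>_. 0) \<in> drain \<longleftrightarrow> set u \<subseteq> {..<6} \<and> count_list u 2 < count_list u 3"
proof
  assume d: "u \<frown> (\<lambda>_. 0) \<in> drain"
  then obtain k where k: "\<And>j. k \<le> j \<Longrightarrow> (u \<frown> (\<lambda>_. 0)) j = 0"
    "count_list (prefix k (u \<frown> (\<lambda>_. 0))) 2 < count_list (prefix k (u \<frown> (\<lambda>_. 0))) 3"
    by (rule drainE) blast
  have c0: "count_list (drop k u) a = 0" if "a \<noteq> 0" for a
  proof -
    have "drop k u ! i = 0" if "i < length (drop k u)" for i
      using k(1)[of "k + i"] that by simp
    then show ?thesis using that by (metis count_list_0_iff in_set_conv_nth)
  qed
  have "count_list (prefix k (u \<frown> (\<lambda>_. 0))) a = count_list u a" if "a \<noteq> 0" for a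
  proof (cases "k \<le> length u")
    case True
    have "count_list u a = count_list (take k u) a + count_list (drop k u) a"
      by (metis append_take_drop_id count_list_append)
    then show ?thesis using True c0[OF that] by simp
  next
    case False
    then show ?thesis using that by (auto simp: count_list_0_iff)
  qed
  from this[of 2] this[of 3] show "set u \<subseteq> {..<6} \<and> count_list u 2 < count_list u 3"
    using k(2) d by (simp add: drain_def two_phase_def omega_words_conc)
next
  assume u: "set u \<subseteq> {..<6} \<and> count_list u 2 < count_list u 3"
  have "u \<frown> (\<lambda>_. 0) \<in> omega_words {..<6}"
    using u by (simp add: omega_words_conc) (simp add: omega_words_def)
  moreover have "count_list u \<in> nvecs 6"
    using u by (auto simp: nvecs_def count_list_0_iff)
  moreover have "0 < length u" using u by auto
  moreover have "count_list ((u \<frown> (\<lambda>_. 0)) [length u + i \<rightarrow> length u + Suc i]) j = 0" if "j \<noteq> 0" for i j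
    using that by (auto simp: subsequence_def)
  ultimately show "u \<frown> (\<lambda>_. 0) \<in> drain"
    unfolding drain_def two_phase_def using u
    by (intro CollectI conjI exI[of _ "\<lambda>i. length u + i"]) (auto simp: strict_mono_def)
qed

lemma conc_zeros_not_rendezvous: "u \<frown> (\<lambda>_. 0) \<notin> rendezvous 4"
proof
  assume "u \<frown> (\<lambda>_. 0) \<in> rendezvous 4"
  then obtain k where k: "count_list (prefix k (u \<frown> (\<lambda>_. 0))) 4 = Suc (count_list u 4)"
    unfolding rendezvous_def by blast
  have "count_list (prefix k (u \<frown> (\<lambda>_. 0))) 4 \<le> count_list u 4"
  proof (cases "k \<le> length u")
    case True
    have "count_list u 4 = count_list (take k u) 4 + count_list (drop k u) 4"
      by (metis append_take_drop_id count_list_append)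
    then show ?thesis using True by simp
  next
    case False
    have "count_list (prefix (k - length u) (\<lambda>_. 0)) (4::nat) = 0" by (auto simp: count_list_0_iff)
    then show ?thesis using False by simp
  qed
  then show False using k by simp
qed

text \<open>
  In \<open>test x (window a b) y\<close>, the excursions in \<open>trips x\<close> allow only rendezvous points at most \<open>x\<close>
  steps east of the origin, whereas the final letters \<open>4\<close> force the point \<open>(y, 0)\<close>. The lengths of the
  excursions run through all residues modulo \<open>L\<close>, so that an automaton with period \<open>L\<close> cannot tell
  which excursion is the shortest one. In between, the long eastward run of the window lies in row \<open>0\<close> if
  \<open>a = L\<close> and in row \<open>L\<close> if \<open>a = 2 * L\<close>.
\<close>

locale probe =
  fixes L K :: nat
  assumes L_pos: "0 < L" and K_pos: "0 < K"
begin

definition climb :: "nat \<Rightarrow> nat list" where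
  "climb n = concat (replicate n (replicate L 2 @ replicate L 0))"

text \<open>For \<open>r < L\<close> congruent to \<open>r\<close> modulo \<open>L\<close>, but
  equal to \<open>x\<close> only for the residue of \<open>x\<close> and larger for all
  others.\<close>

definition bound :: "nat \<Rightarrow> nat \<Rightarrow> nat" where
  "bound x r = (if r = x mod L then x else r + L * Suc x)"

definition trip :: "nat \<Rightarrow> nat \<Rightarrow> nat list" where
  "trip x r = replicate (bound x r) 0 @ replicate (bound x r) 1"

definition trips :: "nat \<Rightarrow> nat \<Rightarrow> nat \<Rightarrow> nat list" where
  "trips x a b = concat (map (\<lambda>r. trip x r @ [4]) [a..<b])"

text \<open>The closing staircase leaves an automaton with period \<open>L\<close> in a state that a
  further \<open>climb L\<close> does not change; the steps west keep it from leading east of the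
  starting column. For \<open>d = Suc L\<close> and \<open>d = Suc (Suc L)\<close> the walk ends
  \<open>L\<close> and \<open>2 * L\<close> rows further south.\<close>

definition descent :: "nat \<Rightarrow> nat list" where
  "descent d = replicate (d * L) 3 @ replicate (L * L) 1 @ climb L"

text \<open>After \<open>replicate L 2\<close>, an automaton with period \<open>L\<close> reads this
  like the rest of \<open>climb L\<close>, as it cannot tell \<open>K * L\<close> steps east from
  \<open>L\<close>.\<close>

definition middle :: "nat list" where
  "middle = replicate (K * L) 0 @ climb (L - 1)"

definition window :: "nat \<Rightarrow> nat \<Rightarrow> nat list" where
  "window a b = replicate a 2 @ middle @ replicate b 2"

definition return :: "nat \<Rightarrow> nat list" where
  "return y = replicate (L * Suc L) 3 @ replicate (K * L + L * (L - 1) - y) 1"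

definition start :: "nat \<Rightarrow> nat list" where
  "start x = trips x 0 L @ descent (Suc L)"

definition test :: "nat \<Rightarrow> nat list \<Rightarrow> nat \<Rightarrow> nat word" where
  "test x w y = start x \<frown> w \<frown> [4] \<frown> return y \<frown> (\<lambda>_. 4)"

lemma bound: "L \<le> x \<Longrightarrow> L \<le> bound x r" "r < L \<Longrightarrow> bound x r mod L = r" "x \<le> bound x r"
proof -
  have "x \<le> L * Suc x" using mult_le_mono[of 1 L x "Suc x"] L_pos by simp
  moreover have "L \<le> L * Suc x" by simp
  ultimately show "L \<le> x \<Longrightarrow> L \<le> bound x r" "r < L \<Longrightarrow> bound x r mod L = r" "x \<le> bound x r"
    by (auto simp: bound_def simp del: mult_Suc_right)
qed

lemma count_climb: "count_list (climb n) a = (if a = 0 \<or> a = 2 then n * L else 0)"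
  by (auto simp: climb_def count_list_concat_replicate count_list_replicate)

lemma pos_trips: "pos (trips x a b) = 0"
proof -
  have "pos (concat (map (\<lambda>r. trip x r @ [4]) rs)) = 0" for rs
    by (induction rs) (simp_all add: pos_append pos_def trip_def count_list_replicate zero_prod_def)
  then show ?thesis by (simp add: trips_def)
qed

lemma count_trips: "count_list (trips x a b) 4 = b - a"
proof -
  have "count_list (concat (map (\<lambda>r. trip x r @ [4]) rs)) 4 = length rs" for rs
    by (induction rs) (simp_all add: trip_def count_list_replicate)
  then show ?thesis by (simp add: trips_def)
qed

lemma last_trips: "trips x a b = [] \<or> last (trips x a b) = 4"
proof -
  have "concat (map (\<lambda>r. trip x r @ [4]) rs) = [] \<or> last (concat (map (\<lambda>r. trip x r @ [4]) rs)) = 4" for rs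
    by (induction rs rule: rev_induct) auto
  then show ?thesis unfolding trips_def by blast
qed

lemma trips_split: "r < L \<Longrightarrow> trips x 0 L = trips x 0 r @ (trip x r @ [4]) @ trips x (Suc r) L"
proof -
  assume r: "r < L"
  then have "[0..<L] = [0..<r] @ r # [Suc r..<L]"
    using upt_add_eq_append[of 0 r "L - r"] upt_conv_Cons[OF r] by simp
  then show ?thesis by (simp add: trips_def)
qed

lemma set_subset:
  "set (trips x a b) \<subseteq> {0, 1, 4}" "set (climb n) \<subseteq> {0, 2}" "set (descent d) \<subseteq> {0, 1, 2, 3}"
  "set middle \<subseteq> {0, 2}" "set (window a b) \<subseteq> {0, 2}" "set (return y) \<subseteq> {1, 3}"
  by (auto simp: trips_def trip_def climb_def descent_def middle_def window_def return_def)

lemma pos_start: "pos (start x) = (0, - int L)"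
  unfolding start_def pos_append pos_trips
  by (simp add: pos_def descent_def count_list_replicate count_climb algebra_simps)

lemma count_start: "count_list (start x) 4 = L"
  using set_subset(3)[of "Suc L"] by (auto simp: start_def count_trips count_list_0_iff)

lemma pos_window: "pos (window a b) = (int (K * L + L * (L - 1)), int (a + b + L * (L - 1)))"
  by (simp add: pos_def window_def middle_def count_list_replicate count_climb algebra_simps)

lemma pos_return:
  assumes "y \<le> K * L"
  shows "pos (return y) = (int y - int (K * L + L * (L - 1)), - int (L * Suc L))"
  using assms by (simp add: pos_def return_def count_list_replicate of_nat_diff)

lemma pos_round:
  assumes "a + b = 3 * L" "y \<le> K * L"
  shows "pos (start x @ window a b @ [4] @ return y) = (int y, 0)"
proof -
  have "int (a + b + L * (L - 1)) = int L + int (L * Suc L)"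
    using assms(1) L_pos by (cases L) (simp_all add: algebra_simps)
  then show ?thesis
    unfolding pos_append pos_start pos_window pos_return[OF assms(2)] by (simp add: pos_def)
qed

lemma test_conc: "test x w y = (start x @ w @ [4] @ return y) \<frown> (\<lambda>_. 4)"
  unfolding test_def conc_conc append_assoc ..

lemma test_omega:
  assumes "set w \<subseteq> {0, 2}"
  shows "test x w y \<in> omega_words {..<6}"
proof -
  have "set (start x @ w @ [4] @ return y) \<subseteq> {..<6}"
    using assms set_subset(1)[of x 0 L] set_subset(3)[of "Suc L"] set_subset(6)[of y]
    by (auto simp: start_def)
  moreover have "(\<lambda>_. 4) \<in> omega_words {..<6::nat}" by (simp add: omega_words_def)
  ultimately show ?thesis unfolding test_conc omega_words_conc by blast
qed

lemma test_not_drain: "test x w y \<notin> drain"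
proof
  assume "test x w y \<in> drain"
  then obtain k where k: "\<And>j. k \<le> j \<Longrightarrow> test x w y j = 0" by (rule drainE) blast
  have "test x w y (length (start x @ w @ [4] @ return y) + k) = 4"
    unfolding test_conc by (rule conc_snd[THEN trans]) simp_all
  then show False using k by simp
qed

text \<open>The point \<open>(x, 0)\<close> is met in each of the first \<open>L\<close> blocks,
  since no excursion is shorter than \<open>x\<close>, in the next block on the eastward run in row
  0, and finally where only separators follow.\<close>

lemma test_in_rendezvous:
  assumes "L \<le> x" "x \<le> K * L"
  shows "test x (window L (2 * L)) x \<in> rendezvous 4"
proof (rule rendezvousI[OF test_omega[OF set_subset(5)], of _ _ _ _ _ "(int x, 0)"])
  fix m
  let ?\<alpha> = "test x (window L (2 * L)) x"
  consider "m < L" | "m = L" | "L < m" by linarith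
  then show "\<exists>u \<beta>. ?\<alpha> = u \<frown> \<beta> \<and> u \<noteq> [] \<and> count_list u 4 = m \<and> pos u = (int x, 0)"
  proof cases
    case 1
    let ?u = "trips x 0 m @ replicate x 0"
    have "replicate (bound x m) 0 = replicate x 0 @ replicate (bound x m - x) (0::nat)"
      using bound(3) by (metis le_add_diff_inverse replicate_add)
    then have "\<exists>w. trips x 0 L = ?u @ w"
      unfolding trips_split[OF 1] trip_def by simp
    then have "\<exists>\<beta>. ?\<alpha> = ?u \<frown> \<beta>"
      by (metis test_def start_def conc_conc)
    moreover have "pos ?u = (int x, 0)"
      unfolding pos_append pos_trips by (simp add: pos_def count_list_replicate)
    moreover have "?u \<noteq> []" using assms L_pos by simp
    moreover have "count_list ?u 4 = m" by (simp add: count_trips count_list_replicate)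
    ultimately show ?thesis by blast
  next
    case 2
    let ?u = "start x @ replicate L 2 @ replicate x 0"
    have "replicate (K * L) 0 = replicate x 0 @ replicate (K * L - x) (0::nat)"
      using assms(2) by (metis le_add_diff_inverse replicate_add)
    then have "\<exists>w. start x @ window L (2 * L) = ?u @ w"
      unfolding window_def middle_def by simp
    then have "\<exists>\<beta>. ?\<alpha> = ?u \<frown> \<beta>" by (metis test_def conc_conc)
    moreover have "pos ?u = (int x, 0)"
      unfolding pos_append pos_start by (simp add: pos_def count_list_replicate)
    moreover have "?u \<noteq> []" using L_pos by simp
    moreover have "count_list ?u 4 = m" using 2 by (simp add: count_start count_list_replicate)
    ultimately show ?thesis by blast
  next
    case 3
    let ?u = "(start x @ window L (2 * L) @ [4] @ return x) @ replicate (m - Suc L) 4"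
    have "(\<lambda>_. 4) = replicate (m - Suc L) 4 \<frown> (\<lambda>_. 4::nat)"
      by (auto simp: conc_def)
    then have "?\<alpha> = ?u \<frown> (\<lambda>_. 4)" unfolding test_def by (metis conc_conc append_assoc)
    moreover have "pos ?u = (int x, 0)"
      unfolding pos_append[of _ "replicate _ _"] using pos_round[of L "2 * L" x x] assms(2)
      by (simp add: pos_def count_list_replicate)
    moreover have "count_list (window L (2 * L)) 4 = 0" "count_list (return x) 4 = 0"
      using set_subset(5)[of L "2 * L"] set_subset(6)[of x] by (auto simp: count_list_0_iff)
    then have "count_list ?u 4 = m" using 3 by (simp add: count_start count_list_replicate)
    ultimately show ?thesis by (intro exI[of _ ?u] exI[of _ "\<lambda>_. 4"]) simp
  qed
qed

text \<open>The trailing letters \<open>4\<close> contain an adjacent pair, which pins the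
  rendezvous point to the end of the walk.\<close>

lemma test_rendezvousE:
  assumes "test x (window a b) y \<in> rendezvous 4" "a + b = 3 * L" "y \<le> K * L"
  shows "\<exists>u \<beta>. test x (window a b) y = u \<frown> \<beta> \<and> count_list u 4 = m \<and> pos u = (int y, 0)"
proof -
  obtain v where v: "\<And>m. \<exists>u \<beta>. test x (window a b) y = u \<frown> \<beta> \<and> count_list u 4 = m \<and> pos u = v"
    using rendezvousE[OF assms(1)] by blast
  have "(\<lambda>_. 4) = [4, 4] \<frown> (\<lambda>_. 4::nat)" by (simp add: fun_eq_iff conc_def nth_Cons')
  then have "test x (window a b) y = (start x @ window a b @ [4] @ return y) \<frown> [4, 4] \<frown> (\<lambda>_. 4)"
    unfolding test_def by (metis conc_conc append_assoc)
  from rendezvous_pinned[OF v this] have "pos ((start x @ window a b @ [4] @ return y) @ [4]) = v" .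
  then have "v = (int y, 0)"
    unfolding pos_append[of _ "[4]"] pos_round[OF assms(2,3)] by (simp add: pos_def)
  then show ?thesis using v by blast
qed

text \<open>The excursion for the residue of \<open>x\<close> reaches only \<open>x\<close> steps
  east, short of the required \<open>y\<close>.\<close>

lemma test_mismatch:
  assumes "a + b = 3 * L" "x < y" "y \<le> K * L"
  shows "test x (window a b) y \<notin> rendezvous 4"
proof
  assume "test x (window a b) y \<in> rendezvous 4"
  let ?r = "x mod L"
  have r: "?r < L" using L_pos by simp
  obtain u \<beta> where u: "test x (window a b) y = u \<frown> \<beta>" "count_list u 4 = ?r" "pos u = (int y, 0)"
    using test_rendezvousE[OF \<open>test x (window a b) y \<in> rendezvous 4\<close> assms(1,3)] by blast
  have "\<exists>\<gamma>. test x (window a b) y = trips x 0 ?r \<frown> (trip x ?r @ [4]) \<frown> \<gamma>"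
    unfolding test_def start_def trips_split[OF r] by (metis conc_conc append_assoc)
  then obtain \<gamma> where e: "u \<frown> \<beta> = trips x 0 ?r \<frown> (trip x ?r @ [4]) \<frown> \<gamma>"
    unfolding u(1) by blast
  have c: "count_list u 4 = count_list (trips x 0 ?r) 4" by (simp add: u(2) count_trips)
  have "4 \<notin> set (trip x ?r)" by (simp add: trip_def)
  then obtain w z where w: "u = trips x 0 ?r @ w" "trip x ?r = w @ z"
    using conc_block[OF e c _ last_trips] by blast
  have "count_list (trip x ?r) 0 = x" by (simp add: trip_def bound_def count_list_replicate)
  then have "count_list w 0 \<le> x" unfolding w(2) by simp
  moreover have "pos w = (int y, 0)" using u(3) unfolding w(1) pos_append pos_trips by simp
  ultimately show False using assms(2) by (simp add: pos_def)
qed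

text \<open>Block \<open>L\<close> misses \<open>(x, 0)\<close>: the descent never gets east of
  column 0, and the first \<open>2 * L\<close> steps of the window lead to row \<open>L\<close>,
  from where the block only continues north and east.\<close>

lemma test_swapped:
  assumes "0 < x" "x \<le> K * L"
  shows "test x (window (2 * L) L) x \<notin> rendezvous 4"
proof
  assume "test x (window (2 * L) L) x \<in> rendezvous 4"
  then obtain u \<beta> where u: "test x (window (2 * L) L) x = u \<frown> \<beta>" "count_list u 4 = L"
    "pos u = (int x, 0)"
    using test_rendezvousE[of x "2 * L" L x L] assms(2) by auto
  let ?b = "descent (Suc L) @ window (2 * L) L"
  have e: "u \<frown> \<beta> = trips x 0 L \<frown> (?b @ [4]) \<frown> return x \<frown> (\<lambda>_. 4)"
    unfolding u(1)[symmetric] test_def start_def conc_conc append_assoc ..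
  have c: "count_list u 4 = count_list (trips x 0 L) 4" by (simp add: u(2) count_trips)
  have "4 \<notin> set ?b" using set_subset(3)[of "Suc L"] set_subset(5)[of "2 * L" L] by auto
  then obtain w z where w: "u = trips x 0 L @ w" "?b = w @ z"
    using conc_block[OF e c _ last_trips] by blast
  have pw: "pos w = (int x, 0)" using u(3) unfolding w(1) pos_append pos_trips by simp
  let ?c = "replicate (Suc L * L) 3 @ replicate (L * L) (1::nat)"
  let ?d = "climb L @ replicate (2 * L) 2"
  have b: "?b = ?c @ ?d @ middle @ replicate L 2"
    by (simp add: descent_def window_def)
  have "w @ z = ?c @ ?d @ middle @ replicate L 2" using w(2) b by simp
  then show False
  proof (cases rule: append3_eq_cases)
    case (1 w')
    have "count_list ?c 0 = 0" by (simp add: count_list_replicate)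
    then have "count_list w 0 = 0" unfolding 1 by simp
    then show False using pw assms(1) by (simp add: pos_def)
  next
    case (2 w' w'')
    have "count_list ?d 0 = L * L" by (simp add: count_list_replicate count_climb)
    then have "count_list w' 0 \<le> L * L" unfolding 2(2) by simp
    then have "int (count_list w' 0) \<le> int L * int L" by (metis of_nat_mono of_nat_mult)
    then show False using pw assms(1) by (simp add: 2(1) pos_def count_list_replicate)
  next
    case (3 w')
    have "set w' \<subseteq> set (middle @ replicate L 2)" unfolding 3(2) by simp
    also have "\<dots> \<subseteq> {0, 2}" using set_subset(4) by auto
    finally have "count_list w' 3 = 0" by (auto simp: count_list_0_iff)
    then show False using pw L_pos
      by (simp add: 3(1) pos_def count_list_replicate count_climb)
  qed
qed

end

section \<open>Counting the reset positions inside the window\<close>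

lemma (in reset_machine) run_concat_replicate:
  "run q (concat (replicate n c)) = ((\<lambda>q. run q c) ^^ n) q"
proof (induction n arbitrary: q)
  case (Suc n)
  then show ?case using funpow_swap1[of "\<lambda>q. run q c" n q] by simp
qed simp

lemma rendezvous_Un_drain_not_in_class:
  "rendezvous 4 \<union> drain \<notin> det_weak_reset_class {..<6}"
proof
  assume in_class: "rendezvous 4 \<union> drain \<in> det_weak_reset_class {..<6}"
  obtain Q :: "nat set" and step wt final good s
    where Q: "finite Q" "s \<in> Q" "\<And>q a. \<lbrakk>q \<in> Q; a \<in> {..<6}\<rbrakk> \<Longrightarrow> step q a \<in> Q"
      and U: "rendezvous 4 \<union> drain =
        {\<alpha> \<in> omega_words {..<6}. reset_machine.accepts step wt final good s \<alpha>}"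
    using in_class by (rule det_weak_reset_class_machine) (rule that)
  interpret reset_machine step wt final good .
  \<comment> \<open>A common period for the action of all words on \<open>Q\<close>.\<close>
  define L :: nat where "L = fact (card Q)"
  \<comment> \<open>The window has \<open>K * L + 2 * L * L + L - 1\<close> inner positions; this
    \<open>K\<close> makes the final count exceed that number by one.\<close>
  define K where "K = 2 * L * L + 2 * L"
  have L: "0 < L" by (simp add: L_def)
  interpret probe L K by unfold_locales (use L in \<open>simp_all add: K_def\<close>)
  have closed: "run q xs \<in> Q" if "q \<in> Q" "set xs \<subseteq> {..<6}" for q xs
    using run_closed[of Q "{..<6}" q xs] Q(3) that by blast
  have cycle: "run q (concat (replicate n c)) = run q (concat (replicate m c))"
    if "q \<in> Q" "set c \<subseteq> {..<6}" "L \<le> n" "L \<le> m" "n mod L = m mod L" for q c n m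
    unfolding run_concat_replicate
    by (rule funpow_fact_eq[OF Q(1)]) (use that closed in \<open>auto simp: L_def\<close>)
  have letter: "run q (replicate n a) = run q (replicate m a)"
    if "q \<in> Q" "a < 6" "L \<le> n" "L \<le> m" "n mod L = m mod L" for q a n m
  proof -
    have rep: "replicate i a = concat (replicate i [a])" for i by (induction i) auto
    show ?thesis unfolding rep by (rule cycle) (use that in auto)
  qed
  have run_trip: "run q (trip x r) = run q (trip L r)" if "q \<in> Q" "r < L" "L \<le> x" for q r x
  proof -
    have b: "L \<le> bound x r" "L \<le> bound L r" "bound x r mod L = bound L r mod L"
      using bound(1)[of x r] bound(1)[of L r] bound(2)[of r x] bound(2)[of r L] that by auto
    have "run q (replicate (bound x r) 0) = run q (replicate (bound L r) 0)"
      by (rule letter) (use that b in auto)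
    moreover have "run q (replicate (bound L r) 0) \<in> Q" by (rule closed) (use that in auto)
    then have "run (run q (replicate (bound L r) 0)) (replicate (bound x r) 1) =
      run (run q (replicate (bound L r) 0)) (replicate (bound L r) 1)"
      by (rule letter) (use b in auto)
    ultimately show ?thesis by (simp add: trip_def)
  qed
  \<comment> \<open>All excursions have length at least \<open>L\<close>, and the residue of each
    length depends only on \<open>r\<close>, so the state does not reveal \<open>x\<close>.\<close>
  have run_trips: "run s (trips x 0 L) = run s (trips L 0 L)" if x: "L \<le> x" for x
  proof -
    have "run q (concat (map (\<lambda>r. trip x r @ [4]) rs)) = run q (concat (map (\<lambda>r. trip L r @ [4]) rs))"
      if "q \<in> Q" "set rs \<subseteq> {..<L}" for q rs
      using that
    proof (induction rs arbitrary: q)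
      case (Cons r rs)
      have "run q (trip L r @ [4]) \<in> Q" by (rule closed) (use Cons in \<open>auto simp: trip_def\<close>)
      then show ?case using Cons run_trip[of q r x] x by simp
    qed simp
    from this[OF Q(2), of "[0..<L]"] show ?thesis by (simp add: trips_def atLeast0LessThan)
  qed
  define t where "t = run s (trips L 0 L)"
  define s0 where "s0 = run s (start L)"
  define s1 where "s1 = run s0 (replicate L 2)"
  have t: "t \<in> Q" unfolding t_def by (rule closed) (use Q set_subset(1)[of L 0 L] in auto)
  have start_Q: "set (start x) \<subseteq> {..<6}" for x
    using set_subset(1)[of x 0 L] set_subset(3)[of "Suc L"] by (auto simp: start_def)
  have s0: "s0 \<in> Q" unfolding s0_def by (rule closed) (use Q start_Q in auto)
  have s1: "s1 \<in> Q" unfolding s1_def by (rule closed) (use s0 in auto)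
  have run_start: "run s (start x) = s0" if "L \<le> x" for x
    using run_trips[OF that] by (simp add: s0_def start_def)
  \<comment> \<open>Descending \<open>L\<close> rows further leads to the same state; this relates a
    word of \<open>drain\<close> to the tests.\<close>
  have s0_descent: "run t (descent (Suc (Suc L))) = s0"
  proof -
    have "run t (replicate (Suc (Suc L) * L) 3) = run t (replicate (Suc L * L) 3)"
      by (rule letter) (use t in auto)
    then show ?thesis by (simp add: s0_def start_def t_def descent_def del: mult_Suc)
  qed
  have climb_s0: "run s0 (climb L) = s0"
  proof -
    define q where "q = run t (replicate (Suc L * L) 3 @ replicate (L * L) 1)"
    have q: "q \<in> Q" unfolding q_def by (rule closed) (use t in auto)
    have "s0 = run q (climb L)" by (simp add: s0_def start_def t_def descent_def q_def)
    moreover have "run q (climb L @ climb L) = run q (climb L)"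
    proof -
      have "climb L @ climb L = climb (L + L)" by (simp add: climb_def replicate_add)
      moreover have "run q (climb (L + L)) = run q (climb L)"
        unfolding climb_def by (rule cycle) (use q in auto)
      ultimately show ?thesis by simp
    qed
    ultimately show ?thesis by simp
  qed
  have s1_double: "run s0 (replicate (2 * L) 2) = s1"
    unfolding s1_def by (rule letter) (use s0 in auto)
  have s1_middle: "run s1 middle = s0"
  proof -
    have "run s1 (replicate (K * L) 0) = run s1 (replicate L 0)"
      by (rule letter) (use s1 K_pos in auto)
    moreover have "climb L = replicate L 2 @ replicate L 0 @ climb (L - 1)"
    proof -
      have "climb (Suc n) = replicate L 2 @ replicate L 0 @ climb n" for n by (simp add: climb_def)
      from this[of "L - 1"] show ?thesis using L by simp
    qed
    ultimately show ?thesis using climb_s0 by (simp add: middle_def s1_def)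
  qed
  let ?W = "window L (2 * L)"
  let ?b = "\<lambda>x. length (start x)"
  let ?n = "length ?W"
  have len: "?n = L + K * L + 2 * L * (L - 1) + 2 * L"
    by (simp add: window_def middle_def climb_def length_concat_replicate)
  \<comment> \<open>The two windows consist of the same pieces read from the same states, in a
    different order. So they agree in state and weight, yet only \<open>?W\<close> gives a word of
    the union; hence some reset falls inside it.\<close>
  have reset: "\<exists>y. 0 < y \<and> y < ?n \<and> cut s (test x ?W x) (?b x + y)" if x: "L \<le> x" "x \<le> K * L" for x
  proof -
    have eq: "test x w x = start x \<frown> w \<frown> ([4] @ return x) \<frown> (\<lambda>_. 4)" for w
      by (simp only: test_def conc_conc append_assoc)
    have "accepts s (test x ?W x)" using test_in_rendezvous[OF x] U by blast
    moreover have "\<not> accepts s (test x (window (2 * L) L) x)"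
      using test_swapped[of x] test_not_drain test_omega[OF set_subset(5)] x L U by fastforce
    ultimately have "\<exists>m. length (start x) < m \<and> m < length (start x) + ?n \<and> cut s (test x ?W x) m"
      using replace_or_cut[of s "start x" ?W "([4] @ return x) \<frown> (\<lambda>_. 4)" "window (2 * L) L"]
      unfolding eq[symmetric]
      by (simp add: run_start[OF x(1)] window_def weight_append s1_middle s1_double s1_def[symmetric] add.commute add.left_commute)
    then obtain m where "length (start x) < m" "m < length (start x) + ?n" "cut s (test x ?W x) m"
      by blast
    then show ?thesis by (intro exI[of _ "m - length (start x)"]) auto
  qed
  then obtain y where y: "\<And>x. L \<le> x \<Longrightarrow> x \<le> K * L \<Longrightarrow>
      0 < y x \<and> y x < ?n \<and> cut s (test x ?W x) (?b x + y x)"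
    by metis
  have pre: "prefix (?b x + i) (test x ?W z) = start x @ take i ?W"
    and suf: "suffix (?b x + i) (test x ?W z) = drop i ?W \<frown> [4] \<frown> return z \<frown> (\<lambda>_. 4)"
    if "i < ?n" for x z i
    using that by (simp_all add: test_def)
  have state: "run s (prefix (?b x + i) (test x ?W x)) = run s0 (take i ?W)" if "L \<le> x" "i < ?n" for x i
    by (simp add: pre[OF that(2)] run_start[OF that(1)])
  \<comment> \<open>Equal offsets would give equal states, and splicing would join the excursions
    for \<open>x\<close> to the return to the larger \<open>z\<close>.\<close>
  have distinct: "y x \<noteq> y z" if "L \<le> x" "x < z" "z \<le> K * L" for x z
  proof
    assume eq: "y x = y z"
    have yx: "y x < ?n" "cut s (test x ?W x) (?b x + y x)" using y[of x] that by auto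
    have yz: "cut s (test z ?W z) (?b z + y x)" using y[of z] that eq by auto
    have "accepts s (prefix (?b x + y x) (test x ?W x) \<frown> suffix (?b z + y x) (test z ?W z))"
      by (rule cut_splice[OF yx(2) yz]) (use state yx(1) that in simp)
    also have "prefix (?b x + y x) (test x ?W x) \<frown> suffix (?b z + y x) (test z ?W z) = test x ?W z"
    proof -
      have "take (y x) ?W @ drop (y x) ?W @ us = ?W @ us" for us
        unfolding append_assoc[symmetric] append_take_drop_id ..
      then show ?thesis
        unfolding pre[OF yx(1)] suf[OF yx(1)] unfolding test_def conc_conc append_assoc by (simp only:)
    qed
    finally have "test x ?W z \<in> rendezvous 4 \<union> drain"
      using U test_omega[OF set_subset(5)] by blast
    then show False using test_mismatch[of L "2 * L" x z] test_not_drain that by auto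
  qed
  \<comment> \<open>Reaches \<open>s1\<close> like the tests, but in row \<open>-L\<close> instead
    of row 0, so that reading \<open>0\<close> forever stays in \<open>drain\<close>.\<close>
  let ?d = "trips L 0 L @ descent (Suc (Suc L)) @ replicate L 2"
  have count_23: "count_list (trips x 0 L) 2 = 0" "count_list (trips x 0 L) 3 = 0" for x
    using set_subset(1)[of x 0 L] by (auto simp: count_list_0_iff)
  have "set ?d \<subseteq> {..<6}" using set_subset(1)[of L 0 L] set_subset(3)[of "Suc (Suc L)"] by auto
  moreover have "count_list ?d 2 < count_list ?d 3"
    using L by (simp add: count_23 descent_def count_list_replicate count_climb)
  ultimately have "?d \<frown> (\<lambda>_. 0) \<in> drain" unfolding conc_zeros_drain_iff by blast
  then have "accepts s (?d \<frown> (\<lambda>_. 0))" using U by blast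
  \<comment> \<open>A late cut ensures that reading \<open>e\<close> zeros acts like reading any
    \<open>z \<ge> L\<close> zeros with the same residue.\<close>
  then obtain m where m: "length ?d + L \<le> m" "cut s (?d \<frown> (\<lambda>_. 0)) m"
    using accepts_cuts by blast
  define e where "e = m - length ?d"
  have e: "L \<le> e" "m = length ?d + e" using m(1) by (simp_all add: e_def)
  have "prefix e (\<lambda>_. 0::nat) = replicate e 0" by (rule nth_equalityI) simp_all
  then have "prefix m (?d \<frown> (\<lambda>_. 0)) = ?d @ replicate e 0"
    unfolding e(2) by (subst prefix_conc_snd) simp_all
  then have state_d: "run s (prefix m (?d \<frown> (\<lambda>_. 0))) = run s1 (replicate e 0)"
    by (simp add: t_def[symmetric] s0_descent s1_def)
  have suf_d: "suffix m (?d \<frown> (\<lambda>_. 0)) = (\<lambda>_. 0)"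
    unfolding e(2) by (subst suffix_conc_snd) (simp_all add: suffix_def)
  \<comment> \<open>A cut at this offset would share its state with the cut of the drained word.
    Then the walk of the test could go on with \<open>0\<close> forever, although it is in row 0 and
    contains only finitely many separators.\<close>
  have blocked: "y x \<noteq> L + z"
    if x: "L \<le> x" "x \<le> K * L" and z: "L \<le> z" "z \<le> K * L" "z mod L = e mod L" for x z
  proof
    assume eq: "y x = L + z"
    have yx: "L + z < ?n" "cut s (test x ?W x) (?b x + (L + z))" using y[OF x] eq by auto
    have "replicate (K * L) (0::nat) = replicate z 0 @ replicate (K * L - z) 0"
      using z(2) by (metis le_add_diff_inverse replicate_add)
    then have take: "take (L + z) ?W = replicate L 2 @ replicate z 0"
      by (simp add: window_def middle_def)
    have "run s1 (replicate z 0) = run s1 (replicate e 0)"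
      by (rule letter) (use s1 z e in auto)
    then have "accepts s (prefix (?b x + (L + z)) (test x ?W x) \<frown> suffix m (?d \<frown> (\<lambda>_. 0)))"
      by (intro cut_splice[OF yx(2) m(2)]) (simp only: state[OF x(1) yx(1)] take state_d foldl_append s1_def)
    then have acc: "accepts s ((start x @ replicate L 2 @ replicate z 0) \<frown> (\<lambda>_. 0))"
      unfolding pre[OF yx(1)] take suf_d .
    have "set (start x @ replicate L 2 @ replicate z 0) \<subseteq> {..<6}" using start_Q[of x] by auto
    moreover have "(\<lambda>_. 0) \<in> omega_words {..<6::nat}" by (simp add: omega_words_def)
    ultimately have "(start x @ replicate L 2 @ replicate z 0) \<frown> (\<lambda>_. 0) \<in> omega_words {..<6}"
      unfolding omega_words_conc ..
    with acc have "(start x @ replicate L 2 @ replicate z 0) \<frown> (\<lambda>_. 0) \<in> rendezvous 4 \<union> drain"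
      unfolding U by (intro CollectI conjI)
    then have "count_list (start x @ replicate L 2 @ replicate z 0) 2
        < count_list (start x @ replicate L 2 @ replicate z 0) 3"
      using conc_zeros_not_rendezvous conc_zeros_drain_iff by blast
    then show False
      by (simp add: start_def count_23 descent_def count_list_replicate count_climb)
  qed
  \<comment> \<open>\<open>?A\<close> holds the offsets serving some \<open>x\<close>, and
    \<open>?B\<close> one blocked offset in each stretch of \<open>L\<close> letters of the eastward
    run after the first stretch.\<close>
  let ?A = "y ` {L..K * L}" and ?B = "(\<lambda>c. L + (c * L + e mod L)) ` {1..<K}"
  have "inj_on y {L..K * L}"
    by (rule linorder_inj_onI) (use distinct in auto)
  then have A: "card ?A = K * L + 1 - L" by (simp add: card_image)
  have "inj_on (\<lambda>c. L + (c * L + e mod L)) {1..<K}" using L by (auto simp: inj_on_def)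
  then have B: "card ?B = K - 1" by (simp add: card_image)
  have B_le: "L \<le> c * L + e mod L" "c * L + e mod L \<le> K * L" if "c \<in> {1..<K}" for c
  proof -
    show "L \<le> c * L + e mod L" using that by (cases c) auto
    have "Suc c * L \<le> K * L" using that by (intro mult_le_mono1) auto
    moreover have "e mod L < L" using L by simp
    ultimately show "c * L + e mod L \<le> K * L" by simp
  qed
  have "?A \<inter> ?B = {}"
  proof -
    have "y x \<noteq> L + (c * L + e mod L)" if "x \<in> {L..K * L}" "c \<in> {1..<K}" for x c
      using blocked[of x "c * L + e mod L"] B_le[OF that(2)] that(1) by simp
    then show ?thesis by blast
  qed
  then have "card (?A \<union> ?B) = (K * L + 1 - L) + (K - 1)"
    by (subst card_Un_disjoint) (simp_all only: A B finite_imageI finite_atLeastAtMost finite_atLeastLessThan)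
  moreover have "?A \<union> ?B \<subseteq> {1..<?n}"
  proof -
    have "y x \<in> {1..<?n}" if "x \<in> {L..K * L}" for x using y[of x] that by auto
    moreover have "L + (c * L + e mod L) \<in> {1..<?n}" if "c \<in> {1..<K}" for c
      using B_le[OF that] L by (simp add: len)
    ultimately show ?thesis by blast
  qed
  then have "card (?A \<union> ?B) \<le> ?n - 1" using card_mono[of "{1..<?n}" "?A \<union> ?B"] by simp
  ultimately have "(K * L + 1 - L) + (K - 1) \<le> L + K * L + 2 * L * (L - 1) + 2 * L - 1"
    unfolding len by simp
  moreover have "2 * L * (L - 1) = 2 * (L * L) - 2 * L" "K = 2 * (L * L) + 2 * L" "L \<le> L * L"
    using L by (simp_all add: diff_mult_distrib2 K_def)
  moreover have "L \<le> K * L" using K_pos by simp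
  ultimately show False using L by linarith
qed

theorem lemma5:
  shows
    "(\<exists>\<Sigma> :: nat set. finite \<Sigma> \<and> \<Sigma> \<noteq> {} \<and>
        (\<exists>L\<^sub>1 \<in> det_weak_reset_class \<Sigma>. \<exists>L\<^sub>2 \<in> det_weak_reset_class \<Sigma>.
           L\<^sub>1 \<union> L\<^sub>2 \<notin> det_weak_reset_class \<Sigma>)) \<and>
     (\<exists>\<Sigma> :: nat set. finite \<Sigma> \<and> \<Sigma> \<noteq> {} \<and>
        (\<exists>L\<^sub>1 \<in> det_weak_reset_class \<Sigma>. \<exists>L\<^sub>2 \<in> det_weak_reset_class \<Sigma>.
           L\<^sub>1 \<inter> L\<^sub>2 \<notin> det_weak_reset_class \<Sigma>)) \<and>
     (\<exists>\<Sigma> :: nat set. finite \<Sigma> \<and> \<Sigma> \<noteq> {} \<and>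
        (\<exists>L \<in> det_weak_reset_class \<Sigma>.
           omega_words \<Sigma> - L \<notin> det_weak_reset_class \<Sigma>))"
proof (intro conjI)
  have \<Sigma>: "finite {..<n}" "{..<n} \<noteq> {}" if "0 < n" for n :: nat
    using that by (auto simp: lessThan_empty_iff bot_nat_def)
  have rendezvous: "rendezvous 4 \<in> det_weak_reset_class {..<6}" "rendezvous 5 \<in> det_weak_reset_class {..<6}"
    by (simp_all add: rendezvous_in_class)
  show "\<exists>\<Sigma> :: nat set. finite \<Sigma> \<and> \<Sigma> \<noteq> {} \<and>
      (\<exists>L\<^sub>1 \<in> det_weak_reset_class \<Sigma>. \<exists>L\<^sub>2 \<in> det_weak_reset_class \<Sigma>.
         L\<^sub>1 \<union> L\<^sub>2 \<notin> det_weak_reset_class \<Sigma>)"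
    using \<Sigma>[of 6] rendezvous(1) drain_in_class rendezvous_Un_drain_not_in_class
    by (metis zero_less_numeral)
  show "\<exists>\<Sigma> :: nat set. finite \<Sigma> \<and> \<Sigma> \<noteq> {} \<and>
      (\<exists>L\<^sub>1 \<in> det_weak_reset_class \<Sigma>. \<exists>L\<^sub>2 \<in> det_weak_reset_class \<Sigma>.
         L\<^sub>1 \<inter> L\<^sub>2 \<notin> det_weak_reset_class \<Sigma>)"
    using \<Sigma>[of 6] rendezvous rendezvous_Int_not_in_class
    by (metis zero_less_numeral)
  show "\<exists>\<Sigma> :: nat set. finite \<Sigma> \<and> \<Sigma> \<noteq> {} \<and>
      (\<exists>L \<in> det_weak_reset_class \<Sigma>. omega_words \<Sigma> - L \<notin> det_weak_reset_class \<Sigma>)"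
    using \<Sigma>[of 3] unsafe_in_class safe_not_in_class
    by (metis zero_less_numeral)
qed

end
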